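(* For every $0\le r<\pi$, the function $B_r$ is superadditive: $B_r(k_1+k_2)\ge B_r(k_1)+B_r(k_2)$ for all integers $k_1,k_2\ge1$. Consequently the limit $$\Lambda(r):=\lim_{k\to\infty}\frac{B_r(k)}k=\sup_{k\ge1}\frac{B_r(k)}k$$ exists in $[1,+\infty]$ (and equals the displayed supremum).
   Context: For $m\ge1$, $\mathbb S^m\subset\mathbb R^{m+1}$ is the unit round sphere with geodesic metric $\arccos\langle x,x'\rangle$; $\mathbb S^0$ is two points at distance $\pi$. The group $C_2$ of order two acts antipodally on each sphere; a map between $C_2$-spaces is odd if it is $C_2$-equivariant. The coindex of a $C_2$-space $X$ is $\mathrm{coind}(X):=\sup\{k\ge0:\text{there is a continuous odd map }\mathbb S^k\to X\}$. $\mathrm{VR}(X;r)$ is the geometric realization of the simplicial complex with vertex set $X$ whose simplices are the nonempty finite subsets of diameter at most $r$; $\mathrm{VR}(\mathbb S^m;r)$ carries the $C_2$-action induced by the antipodal map. For integers $0\le m\le n$, $c_{m,n}:=\inf\{r\ge0:\mathrm{coind}(\mathrm{VR}(\mathbb S^m;r))\ge n\}$. For $0\le r<\pi$ and an integer $k\ge1$, $B_r(k):=\max\{\ell\ge k:\ c_{k-1,\ell-1}\le r\}$, which is a well-defined finite maximum. *)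

theory Defs
  imports "HOL-Analysis.Analysis" "HOL-Library.Extended_Nat" "HOL-Library.Extended_Real"
begin

section \<open>Geometric realization of a simplicial complex\<close>

text \<open>
  A simplicial complex is given by its set \<open>K\<close> of simplices (nonempty finite sets of vertices).
  A point of the realization is its barycentric coordinate function, extended by 0
  to the whole vertex type.
\<close>

definition closed_simplex :: "'v set \<Rightarrow> ('v \<Rightarrow> real) set" where
  "closed_simplex \<sigma> = {u. (\<forall>v. 0 \<le> u v) \<and> (\<forall>v. v \<notin> \<sigma> \<longrightarrow> u v = 0) \<and> (\<Sum>v\<in>\<sigma>. u v) = 1}"

text \<open>
  The weak (coherent) topology. For finite \<open>\<sigma>\<close> the product topology restricted to
  \<open>closed_simplex \<sigma>\<close> is the Euclidean topology of the simplex.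
\<close>

definition geom_realization :: "'v set set \<Rightarrow> ('v \<Rightarrow> real) topology" where
  "geom_realization K = topology (\<lambda>U. U \<subseteq> (\<Union>\<sigma>\<in>K. closed_simplex \<sigma>) \<and>
     (\<forall>\<sigma>\<in>K. openin (subtopology (powertop_real UNIV) (closed_simplex \<sigma>)) (U \<inter> closed_simplex \<sigma>)))"

lemma istopology_geom_realization:
  "istopology (\<lambda>U. U \<subseteq> (\<Union>\<sigma>\<in>K. closed_simplex \<sigma>) \<and>
     (\<forall>\<sigma>\<in>K. openin (subtopology (powertop_real UNIV) (closed_simplex \<sigma>)) (U \<inter> closed_simplex \<sigma>)))"
    (is "istopology ?P")
  unfolding istopology_def
proof (rule conjI; intro allI impI)
  fix S T assume S: "?P S" and T: "?P T"
  have "openin (subtopology (powertop_real UNIV) (closed_simplex \<sigma>)) (S \<inter> T \<inter> closed_simplex \<sigma>)"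
    if "\<sigma> \<in> K" for \<sigma>
  proof -
    have "S \<inter> T \<inter> closed_simplex \<sigma> = (S \<inter> closed_simplex \<sigma>) \<inter> (T \<inter> closed_simplex \<sigma>)"
      by blast
    then show ?thesis
      using S T that by (metis openin_Int)
  qed
  then show "?P (S \<inter> T)"
    using S by blast
next
  fix \<U> assume U: "\<forall>U\<in>\<U>. ?P U"
  have "openin (subtopology (powertop_real UNIV) (closed_simplex \<sigma>)) (\<Union>\<U> \<inter> closed_simplex \<sigma>)"
    if "\<sigma> \<in> K" for \<sigma>
  proof -
    have eq: "\<Union>\<U> \<inter> closed_simplex \<sigma> = \<Union> ((\<lambda>U. U \<inter> closed_simplex \<sigma>) ` \<U>)"
      by blast
    show ?thesis
      unfolding eq using U that by (intro openin_Union) blast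
  qed
  then show "?P (\<Union>\<U>)"
    using U by blast
qed

lemma openin_geom_realization:
  "openin (geom_realization K) U \<longleftrightarrow> U \<subseteq> (\<Union>\<sigma>\<in>K. closed_simplex \<sigma>) \<and>
     (\<forall>\<sigma>\<in>K. openin (subtopology (powertop_real UNIV) (closed_simplex \<sigma>)) (U \<inter> closed_simplex \<sigma>))"
  unfolding geom_realization_def by (simp add: topology_inverse' istopology_geom_realization)

lemma topspace_geom_realization: "topspace (geom_realization K) = (\<Union>\<sigma>\<in>K. closed_simplex \<sigma>)"
proof -
  have "openin (subtopology (powertop_real UNIV) (closed_simplex \<sigma>))
          ((\<Union>\<tau>\<in>K. closed_simplex \<tau>) \<inter> closed_simplex \<sigma>)" if "\<sigma> \<in> K" for \<sigma> :: "'a set"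
  proof -
    have "(\<Union>\<tau>\<in>K. closed_simplex \<tau>) \<inter> closed_simplex \<sigma>
            = topspace (subtopology (powertop_real UNIV) (closed_simplex \<sigma>))"
      using that by auto
    then show ?thesis
      by (metis openin_topspace)
  qed
  then have "openin (geom_realization K) (\<Union>\<sigma>\<in>K. closed_simplex \<sigma>)"
    by (auto simp: openin_geom_realization)
  then show ?thesis
    by (meson openin_geom_realization openin_subset openin_topspace subset_antisym)
qed


section \<open>Vietoris--Rips complexes\<close>

definition diam :: "('v \<Rightarrow> 'v \<Rightarrow> real) \<Rightarrow> 'v set \<Rightarrow> real" where
  "diam d \<sigma> = (SUP (x, y)\<in>\<sigma> \<times> \<sigma>. d x y)"

definition VR_simplices :: "'v set \<Rightarrow> ('v \<Rightarrow> 'v \<Rightarrow> real) \<Rightarrow> real \<Rightarrow> 'v set set" where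
  "VR_simplices V d r = {\<sigma>. \<sigma> \<subseteq> V \<and> finite \<sigma> \<and> \<sigma> \<noteq> {} \<and> diam d \<sigma> \<le> r}"

definition VR :: "'v set \<Rightarrow> ('v \<Rightarrow> 'v \<Rightarrow> real) \<Rightarrow> real \<Rightarrow> ('v \<Rightarrow> real) topology" where
  "VR V d r = geom_realization (VR_simplices V d r)"

lemma diam_le_iff:
  assumes "finite \<sigma>" "\<sigma> \<noteq> {}"
  shows "diam d \<sigma> \<le> r \<longleftrightarrow> (\<forall>x\<in>\<sigma>. \<forall>y\<in>\<sigma>. d x y \<le> r)"
proof -
  have "bdd_above ((\<lambda>(x, y). d x y) ` (\<sigma> \<times> \<sigma>))"
    using assms(1) by (intro bdd_above_finite) auto
  then show ?thesis
    using assms(2) unfolding diam_def by (subst cSUP_le_iff) auto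
qed


section \<open>Spheres, odd maps and the coindex\<close>

text \<open>
  The unit sphere of dimension \<open>m\<close> is \<^term>\<open>nsphere m\<close>: its points are the functions
  \<open>x :: nat \<Rightarrow> real\<close> with \<open>(\<Sum>i\<le>m. (x i)\<^sup>2) = 1\<close> that vanish at all indices above \<open>m\<close>.
\<close>

definition sphere_dist :: "nat \<Rightarrow> (nat \<Rightarrow> real) \<Rightarrow> (nat \<Rightarrow> real) \<Rightarrow> real" where
  "sphere_dist m x y = arccos (\<Sum>i\<le>m. x i * y i)"

definition antipode :: "(nat \<Rightarrow> real) \<Rightarrow> (nat \<Rightarrow> real)" where
  "antipode x = (\<lambda>i. - x i)"

text \<open>
  A space with an action of the group of order two is a topology together with
  the involution by which the generator acts.
\<close>

definition coind :: "'a topology \<Rightarrow> ('a \<Rightarrow> 'a) \<Rightarrow> enat" where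
  "coind X \<tau> = Sup {enat k |k. \<exists>f. continuous_map (nsphere k) X f \<and>
                        (\<forall>x\<in>topspace (nsphere k). f (antipode x) = \<tau> (f x))}"

definition VR_sphere :: "nat \<Rightarrow> real \<Rightarrow> ((nat \<Rightarrow> real) \<Rightarrow> real) topology" where
  "VR_sphere m r = VR (topspace (nsphere m)) (sphere_dist m) r"

text \<open>
  The simplicial map induced by \<open>antipode\<close>: it moves the weight at \<open>x\<close> to \<open>antipode x\<close>; as
  \<open>antipode\<close> is its own inverse, this is precomposition with \<open>antipode\<close>.
\<close>

definition VR_antipode :: "((nat \<Rightarrow> real) \<Rightarrow> real) \<Rightarrow> ((nat \<Rightarrow> real) \<Rightarrow> real)" where
  "VR_antipode u = (\<lambda>x. u (antipode x))"


section \<open>The constants and the growth rate\<close>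

definition c_VR :: "nat \<Rightarrow> nat \<Rightarrow> real" where
  "c_VR m n = Inf {r. 0 \<le> r \<and> enat n \<le> coind (VR_sphere m r) VR_antipode}"

text \<open>Only meaningful for \<open>k \<ge> 1\<close> and \<open>0 \<le> r < \<pi>\<close>, where the set is finite and nonempty.\<close>

definition B_VR :: "real \<Rightarrow> nat \<Rightarrow> nat" where
  "B_VR r k = Max {l. k \<le> l \<and> c_VR (k - 1) (l - 1) \<le> r}"

definition Lambda_VR :: "real \<Rightarrow> ereal" where
  "Lambda_VR r = lim (\<lambda>k. ereal (real (B_VR r k) / real k))"

end

theory Submission
  imports Defs "HOL-Homology.Homology"
begin

text \<open>
  Superadditivity comes from joins. Odd maps from the spheres of dimensions \<open>n1\<close> and \<open>n2\<close> to
  the Vietoris--Rips complexes of the spheres of dimensions \<open>m1\<close> and \<open>m2\<close> at a scale \<open>r\<close> have as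
  their join an odd map from the sphere of dimension \<open>n1 + n2 + 1\<close>. Placing the two vertex
  spheres in orthogonal coordinate blocks of the sphere of dimension \<open>m1 + m2 + 1\<close>, a vertex of
  one block has distance \<open>\<pi> / 2\<close> from every vertex of the other, so for \<open>r \<ge> \<pi> / 2\<close> the join of two
  simplices is again a simplex at scale \<open>r\<close> (\<open>odd_map_VR_join\<close>). Below \<open>\<pi> / 2\<close> nothing has to be
  joined: there a convex combination of the vertices of a simplex is a nonzero vector, its
  coordinates are odd functions without common zero, and the Borsuk--Ulam theorem forces \<open>n \<le> m\<close>,
  so that \<open>B_VR r k = k\<close>.

  The numbers \<open>B_VR r k\<close> are maxima of finite nonempty sets. Nonemptiness follows from
  \<open>c_VR m m = 0\<close>, for which a partition of unity subordinate to a finite antipodally symmetric net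
  maps the sphere to its own complex at any positive scale (\<open>odd_map_VR_self\<close>). Finiteness is
  again Borsuk--Ulam: for \<open>r < \<pi>\<close> cover the sphere by finitely many pairs of small antipodal
  pieces; no simplex at scale \<open>r\<close> meets both pieces of a pair, so the signed masses that a point
  of the complex puts on the pairs are finitely many odd functions without common zero
  (\<open>odd_map_VR_bounded\<close>).

  The Borsuk--Ulam theorem is proved on singular chains. As the lower homology of the sphere
  vanishes, there are chains whose boundary is the sum of the previous chain and, up to sign, its
  antipodal image. On a chain of such a tower a product of sign-change cochains of the given odd
  functions takes an odd value, and this value would be zero once the chains are subdivided so
  finely that on each simplex one of the functions keeps its sign.

  The statement on the limit is Fekete's lemma for superadditive sequences.
\<close>

section \<open>Products of sign changes on singular chains\<close>

text \<open>The index in a simplex of the \<open>j\<close>-th vertex of its \<open>i\<close>-th face.\<close>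
definition face_index :: "nat \<Rightarrow> nat \<Rightarrow> nat" where
  "face_index i j = (if j < i then j else Suc j)"

definition vertex :: "((nat \<Rightarrow> real) \<Rightarrow> 'a) \<Rightarrow> nat \<Rightarrow> 'a" where
  "vertex \<sigma> i = \<sigma> (\<lambda>j. if j = i then 1 else 0)"

text \<open>
  The cup product of the coboundaries of the \<open>0\<close>-cochains \<open>h 0\<close>, ..., \<open>h (k - 1)\<close>, on the
  simplex with vertices \<open>v 0\<close>, ..., \<open>v k\<close>.
\<close>
definition cup_diff :: "(nat \<Rightarrow> 'a \<Rightarrow> int) \<Rightarrow> nat \<Rightarrow> (nat \<Rightarrow> 'a) \<Rightarrow> int" where
  "cup_diff h k v = (\<Prod>j<k. h j (v (Suc j)) - h j (v j))"

definition chain_eval :: "('b \<Rightarrow> int) \<Rightarrow> ('b \<Rightarrow>\<^sub>0 int) \<Rightarrow> int" where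
  "chain_eval \<phi> c = (\<Sum>\<sigma>\<in>Poly_Mapping.keys c. Poly_Mapping.lookup c \<sigma> * \<phi> \<sigma>)"

lemma cup_diff_Suc:
  "cup_diff h (Suc k) v = cup_diff h k v * (h k (v (Suc k)) - h k (v k))"
  by (simp add: cup_diff_def)

lemma cup_diff_cong: "(\<And>j. j \<le> k \<Longrightarrow> v j = w j) \<Longrightarrow> cup_diff h k v = cup_diff h k w"
  by (simp add: cup_diff_def)

lemma cup_diff_last_face: "cup_diff h k (\<lambda>j. v (face_index (Suc k) j)) = cup_diff h k v"
  by (rule cup_diff_cong) (simp add: face_index_def)

text \<open>
  A cup product of coboundaries is a cocycle. In the induction the last factor only sees the last
  two vertices, so all faces but the last two contribute a common factor, and the remaining
  differences of \<open>h k\<close> around the triangle of the last three vertices cancel.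
\<close>
lemma cup_diff_cocycle:
  "(\<Sum>i\<le>Suc k. (-1) ^ i * cup_diff h k (\<lambda>j. v (face_index i j))) = 0"
proof (induction k)
  case 0
  show ?case by (simp add: cup_diff_def)
next
  case (Suc k)
  define D where "D = (\<lambda>x y. h k y - h k x)"
  note last = cup_diff_last_face[of h k v]
  have 1: "cup_diff h (Suc k) (\<lambda>j. v (face_index i j))
      = cup_diff h k (\<lambda>j. v (face_index i j)) * D (v (Suc k)) (v (Suc (Suc k)))" if "i \<le> k" for i
    using that by (simp add: cup_diff_Suc D_def face_index_def)
  have 2: "cup_diff h (Suc k) (\<lambda>j. v (face_index (Suc k) j)) = cup_diff h k v * D (v k) (v (Suc (Suc k)))"
    by (simp add: cup_diff_Suc last) (simp add: D_def face_index_def)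
  have 3: "cup_diff h (Suc k) (\<lambda>j. v (face_index (Suc (Suc k)) j)) = cup_diff h k v * D (v k) (v (Suc k))"
    unfolding cup_diff_last_face[of h "Suc k" v] by (simp add: cup_diff_Suc D_def)
  have IH: "(\<Sum>i\<le>k. (-1) ^ i * cup_diff h k (\<lambda>j. v (face_index i j))) = (-1) ^ k * cup_diff h k v"
    using Suc.IH by (simp add: last)
  have "(\<Sum>i\<le>k. (-1) ^ i * cup_diff h (Suc k) (\<lambda>j. v (face_index i j)))
      = (\<Sum>i\<le>k. (-1) ^ i * cup_diff h k (\<lambda>j. v (face_index i j))) * D (v (Suc k)) (v (Suc (Suc k)))"
    by (simp add: 1 sum_distrib_right mult.assoc)
  then have "(\<Sum>i\<le>Suc (Suc k). (-1) ^ i * cup_diff h (Suc k) (\<lambda>j. v (face_index i j)))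
      = (-1) ^ k * cup_diff h k v * (D (v (Suc k)) (v (Suc (Suc k))) - D (v k) (v (Suc (Suc k))) + D (v k) (v (Suc k)))"
    by (simp add: IH 2 3 algebra_simps)
  also have "\<dots> = 0" by (simp add: D_def)
  finally show ?case .
qed

text \<open>
  Multiplying \<open>cup_diff h k\<close> by the value of \<open>h k\<close> at the last vertex gives a primitive of the next
  cup product. All faces but the last one end in \<open>v (k + 1)\<close>, so by the cocycle property they
  contribute, up to sign, \<open>h k (v (k + 1))\<close> times the cup product on the last face.
\<close>
lemma coboundary_cup_diff:
  "(\<Sum>i\<le>Suc k. (-1) ^ i * (cup_diff h k (\<lambda>j. v (face_index i j)) * h k (v (face_index i k))))
     = (-1) ^ k * cup_diff h (Suc k) v"
proof -
  note last = cup_diff_last_face[of h k v]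
  have IH: "(\<Sum>i\<le>k. (-1) ^ i * cup_diff h k (\<lambda>j. v (face_index i j))) = (-1) ^ k * cup_diff h k v"
    using cup_diff_cocycle[where h=h and k=k and v=v] by (simp add: last)
  have "(\<Sum>i\<le>k. (-1) ^ i * (cup_diff h k (\<lambda>j. v (face_index i j)) * h k (v (face_index i k))))
      = (\<Sum>i\<le>k. (-1) ^ i * cup_diff h k (\<lambda>j. v (face_index i j))) * h k (v (Suc k))"
    by (simp add: sum_distrib_right mult.assoc face_index_def)
  then show ?thesis
    by (simp add: IH last cup_diff_Suc) (simp add: face_index_def algebra_simps)
qed

lemma chain_eval_superset:
  assumes "finite A" "Poly_Mapping.keys c \<subseteq> A"
  shows "chain_eval \<phi> c = (\<Sum>\<sigma>\<in>A. Poly_Mapping.lookup c \<sigma> * \<phi> \<sigma>)"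
  unfolding chain_eval_def using assms
  by (intro sum.mono_neutral_left) (auto simp: in_keys_iff)

lemma chain_eval_0 [simp]: "chain_eval \<phi> 0 = 0"
  by (simp add: chain_eval_def)

lemma chain_eval_frag_of [simp]: "chain_eval \<phi> (frag_of \<sigma>) = \<phi> \<sigma>"
  by (simp add: chain_eval_def)

lemma chain_eval_add: "chain_eval \<phi> (a + b) = chain_eval \<phi> a + chain_eval \<phi> b"
proof -
  let ?A = "Poly_Mapping.keys a \<union> Poly_Mapping.keys b"
  have "Poly_Mapping.keys (a + b) \<subseteq> ?A" by (rule Poly_Mapping.keys_add)
  then show ?thesis
    by (simp add: chain_eval_superset[of ?A] lookup_add sum.distrib distrib_right)
qed

lemma chain_eval_cmul: "chain_eval \<phi> (frag_cmul k c) = k * chain_eval \<phi> c"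
proof -
  have "Poly_Mapping.keys (frag_cmul k c) \<subseteq> Poly_Mapping.keys c" by (rule keys_cmul)
  then show ?thesis
    by (simp add: chain_eval_superset[of "Poly_Mapping.keys c"] sum_distrib_left mult.assoc)
qed

lemma chain_eval_sum: "finite I \<Longrightarrow> chain_eval \<phi> (sum c I) = (\<Sum>i\<in>I. chain_eval \<phi> (c i))"
  by (induction I rule: finite_induct) (simp_all add: chain_eval_add)

lemma chain_eval_frag_extend:
  "chain_eval \<phi> (frag_extend f c) = chain_eval (\<lambda>\<sigma>. chain_eval \<phi> (f \<sigma>)) c"
  by (simp add: frag_extend_def chain_eval_sum chain_eval_cmul) (simp add: chain_eval_def)

lemma chain_eval_cong:
  "(\<And>\<sigma>. \<sigma> \<in> Poly_Mapping.keys c \<Longrightarrow> \<phi> \<sigma> = \<psi> \<sigma>) \<Longrightarrow> chain_eval \<phi> c = chain_eval \<psi> c"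
  by (simp add: chain_eval_def)

lemma chain_eval_lincomb:
  "chain_eval (\<lambda>\<sigma>. x * \<phi> \<sigma> + y * \<psi> \<sigma>) c = x * chain_eval \<phi> c + y * chain_eval \<psi> c"
  by (simp add: chain_eval_def sum.distrib sum_distrib_left algebra_simps)

lemma vertex_singular_face:
  assumes "i \<le> Suc p" "j \<le> p"
  shows "vertex (singular_face (Suc p) i \<sigma>) j = vertex \<sigma> (face_index i j)"
proof -
  have "simplical_face i (\<lambda>l. if l = j then 1 else 0) = (\<lambda>l. if l = face_index i j then 1 else (0::real))"
    by (auto simp: simplical_face_def face_index_def fun_eq_iff)
  then show ?thesis
    using assms by (simp add: vertex_def singular_face_def)
qed

lemma vertex_simplex_map: "j \<le> p \<Longrightarrow> vertex (simplex_map p g \<sigma>) j = g (vertex \<sigma> j)"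
  by (simp add: vertex_def simplex_map_def)

lemma chain_eval_chain_boundary:
  "chain_eval \<phi> (chain_boundary (Suc p) c)
     = chain_eval (\<lambda>\<sigma>. \<Sum>i\<le>Suc p. (-1) ^ i * \<phi> (singular_face (Suc p) i \<sigma>)) c"
  by (simp add: chain_boundary_def chain_eval_frag_extend chain_eval_sum chain_eval_cmul chain_eval_add
      del: sum.atMost_Suc)

lemma chain_eval_chain_map:
  "chain_eval \<phi> (chain_map p g c) = chain_eval (\<lambda>\<sigma>. \<phi> (simplex_map p g \<sigma>)) c"
  by (simp add: chain_map_def chain_eval_frag_extend)

definition cup_cochain :: "(nat \<Rightarrow> 'a \<Rightarrow> int) \<Rightarrow> nat \<Rightarrow> ((nat \<Rightarrow> real) \<Rightarrow> 'a) \<Rightarrow> int" where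
  "cup_cochain h k \<sigma> = cup_diff h k (vertex \<sigma>)"

text \<open>
  The inductive step of the Borsuk--Ulam argument. Evaluating the next cup product on \<open>c'\<close> amounts
  to evaluating its primitive on the boundary of \<open>c'\<close>, that is on \<open>c\<close> and on its image under \<open>T\<close>. Since
  \<open>T\<close> replaces \<open>h j\<close> by \<open>1 - h j\<close>, it multiplies the cup product by \<open>(-1) ^ k\<close>, and the two
  contributions add up to the old cup product on \<open>c\<close> up to an even number.
\<close>
lemma odd_pairing_step:
  assumes c: "chain_boundary (Suc k) c' = c + frag_cmul ((-1) ^ Suc k) (chain_map k T c)"
    and h: "\<And>\<sigma> j i. \<sigma> \<in> Poly_Mapping.keys c \<Longrightarrow> j \<le> k \<Longrightarrow> i \<le> k \<Longrightarrow> h j (T (vertex \<sigma> i)) = 1 - h j (vertex \<sigma> i)"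
    and odd: "odd (chain_eval (cup_cochain h k) c)"
  shows "odd (chain_eval (cup_cochain h (Suc k)) c')"
proof -
  define a where "a = (\<lambda>\<sigma>. cup_cochain h k \<sigma> * h k (vertex \<sigma> k))"
  have T: "a (simplex_map k T \<sigma>) = (-1) ^ k * cup_cochain h k \<sigma> * (1 - h k (vertex \<sigma> k))"
    if "\<sigma> \<in> Poly_Mapping.keys c" for \<sigma>
  proof -
    have "cup_cochain h k (simplex_map k T \<sigma>) = (\<Prod>j<k. (-1) * (h j (vertex \<sigma> (Suc j)) - h j (vertex \<sigma> j)))"
      unfolding cup_cochain_def cup_diff_def
      by (rule prod.cong) (use that in \<open>auto simp: vertex_simplex_map h\<close>)
    also have "\<dots> = (-1) ^ k * cup_cochain h k \<sigma>"
      by (subst prod.distrib) (simp add: cup_cochain_def cup_diff_def)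
    finally show ?thesis
      using that by (simp add: a_def vertex_simplex_map h)
  qed
  have "(-1) ^ k * chain_eval (cup_cochain h (Suc k)) c'
      = chain_eval (\<lambda>\<sigma>. (-1) ^ k * cup_diff h (Suc k) (vertex \<sigma>)) c'"
    using chain_eval_lincomb[of "(-1) ^ k" "cup_cochain h (Suc k)" 0 "\<lambda>_. 0" c'] by (simp add: cup_cochain_def)
  also have "\<dots> = chain_eval a (chain_boundary (Suc k) c')"
    unfolding chain_eval_chain_boundary
  proof (rule chain_eval_cong)
    fix \<sigma>
    have "a (singular_face (Suc k) i \<sigma>)
        = cup_diff h k (\<lambda>j. vertex \<sigma> (face_index i j)) * h k (vertex \<sigma> (face_index i k))" if "i \<le> Suc k" for i
    proof -
      have "cup_diff h k (vertex (singular_face (Suc k) i \<sigma>)) = cup_diff h k (\<lambda>j. vertex \<sigma> (face_index i j))"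
        by (rule cup_diff_cong) (simp add: vertex_singular_face that)
      then show ?thesis
        by (simp add: a_def cup_cochain_def vertex_singular_face that)
    qed
    then show "(-1) ^ k * cup_diff h (Suc k) (vertex \<sigma>)
        = (\<Sum>i\<le>Suc k. (-1) ^ i * a (singular_face (Suc k) i \<sigma>))"
      using coboundary_cup_diff[of h k "vertex \<sigma>"] by (simp del: sum.atMost_Suc)
  qed
  also have "\<dots> = chain_eval a c + (-1) ^ Suc k * chain_eval (\<lambda>\<sigma>. a (simplex_map k T \<sigma>)) c"
    by (simp add: c chain_eval_add chain_eval_cmul chain_eval_chain_map del: power_Suc)
  also have "\<dots> = chain_eval (\<lambda>\<sigma>. 1 * a \<sigma> + (-1) ^ Suc k * a (simplex_map k T \<sigma>)) c"
    using chain_eval_lincomb[of 1 a "(-1) ^ Suc k" "\<lambda>\<sigma>. a (simplex_map k T \<sigma>)" c] by simp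
  also have "\<dots> = chain_eval (\<lambda>\<sigma>. 2 * a \<sigma> + (-1) * cup_cochain h k \<sigma>) c"
  proof (rule chain_eval_cong)
    fix \<sigma> assume \<sigma>: "\<sigma> \<in> Poly_Mapping.keys c"
    have "(-1) ^ Suc k * ((-1) ^ k * y) = - y" for y :: int
      by (simp flip: mult.assoc power_mult_distrib)
    then show "1 * a \<sigma> + (-1) ^ Suc k * a (simplex_map k T \<sigma>) = 2 * a \<sigma> + (-1) * cup_cochain h k \<sigma>"
      unfolding T[OF \<sigma>] mult.assoc by (simp add: a_def right_diff_distrib)
  qed
  also have "\<dots> = 2 * chain_eval a c - chain_eval (cup_cochain h k) c"
    using chain_eval_lincomb[of 2 a "-1" "cup_cochain h k" c] by simp
  finally have "odd ((-1) ^ k * chain_eval (cup_cochain h (Suc k)) c')"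
    using odd by simp
  then show ?thesis by simp
qed

section \<open>The Borsuk--Ulam theorem\<close>

lemma sphere_cycle_bounds:
  assumes "singular_chain p (nsphere n) z" "chain_boundary p z = 0" "0 < p" "p \<noteq> n"
  shows "\<exists>d. singular_chain (Suc p) (nsphere n) d \<and> chain_boundary (Suc p) d = z"
proof -
  have "trivial_group (homology_group (int p) (nsphere n))"
    using trivial_reduced_homology_group_nsphere[of "int p" n] assms by (simp add: un_reduced_homology_group)
  moreover have "singular_relcycle p (nsphere n) {} z"
    using assms by (simp add: singular_cycle)
  then have "homologous_rel_set p (nsphere n) {} z \<in> carrier (homology_group (int p) (nsphere n))"
    by (auto simp: carrier_relative_homology_group)
  ultimately have "homologous_rel_set p (nsphere n) {} z = singular_relboundary_set p (nsphere n) {}"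
    by (auto simp: trivial_group_def)
  then have "singular_relboundary p (nsphere n) {} z"
    by (simp add: homologous_rel_set_eq_relboundary)
  then show ?thesis
    by (simp add: singular_boundary)
qed

lemma antipode_nsphere [simp]: "antipode x \<in> topspace (nsphere n) \<longleftrightarrow> x \<in> topspace (nsphere n)"
  by (simp add: nsphere antipode_def)

lemma antipode_antipode [simp]: "antipode (antipode x) = x"
  by (simp add: antipode_def)

lemma continuous_map_antipode: "continuous_map (nsphere n) (nsphere n) antipode"
proof -
  have "continuous_map (nsphere n) (powertop_real UNIV) antipode"
    unfolding continuous_map_componentwise_UNIV antipode_def
    by (auto intro!: continuous_map_minus continuous_map_nsphere_projection)
  moreover have "antipode \<in> topspace (nsphere n) \<rightarrow> {x. (\<Sum>i\<le>n. (x i)\<^sup>2) = 1 \<and> (\<forall>i>n. x i = 0)}"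
    by (auto simp: nsphere antipode_def)
  ultimately show ?thesis
    by (subst (2) nsphere) (simp add: continuous_map_in_subtopology Collect_conj_eq)
qed

lemma path_gives_chain:
  assumes "pathin X g"
  shows "\<exists>d. singular_chain (Suc 0) X d \<and> chain_boundary (Suc 0) d
     = frag_of (restrict (\<lambda>_. g 0) (standard_simplex 0)) - frag_of (restrict (\<lambda>_. g 1) (standard_simplex 0))"
proof -
  let ?Y = "subtopology X (g ` {0..1})"
  have "path_connected_space ?Y"
    using path_connectedin_path_image[OF assms] by (simp add: path_connectedin_def)
  moreover have "singular_simplex 0 ?Y (restrict (\<lambda>_. g t) (standard_simplex 0))" if "t \<in> {0..1}" for t
    using that path_image_subset_topspace[OF assms] by (auto simp: singular_simplex_def)
  ultimately have "homologous_rel 0 ?Y {} (frag_of (restrict (\<lambda>_. g 0) (standard_simplex 0)))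
      (frag_of (restrict (\<lambda>_. g 1) (standard_simplex 0)))"
    by (intro iso_integer_zeroth_homology_group_aux) auto
  then show ?thesis
    using singular_boundary_mono[of "g ` {0..1}" UNIV 0 X]
    by (simp add: homologous_rel_def singular_boundary)
qed

definition pole :: "nat \<Rightarrow> real" where
  "pole i = (if i = 0 then 1 else 0)"

lemma pole_in_nsphere: "pole \<in> topspace (nsphere n)"
  using in_topspace_nsphere[of n] by (simp add: pole_def[abs_def])

lemma antipodal_path:
  assumes "0 < n"
  shows "\<exists>g. pathin (nsphere n) g \<and> g 0 = pole \<and> g 1 = antipode pole"
proof (intro exI conjI)
  define g where "g = (\<lambda>t i. if i = 0 then cos (pi * t) else if i = Suc 0 then sin (pi * t) else (0::real))"
  have "(\<Sum>i\<le>n. (g t i)\<^sup>2) = 1" for t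
  proof -
    have "(\<Sum>i\<le>n. (g t i)\<^sup>2) = (\<Sum>i\<in>{0, Suc 0}. (g t i)\<^sup>2)"
      using assms by (intro sum.mono_neutral_right) (auto simp: g_def)
    then show ?thesis
      by (simp add: g_def)
  qed
  moreover have "g t i = 0" if "i > n" for t i
    using that assms by (auto simp: g_def)
  moreover have "continuous_map (top_of_set {0..1}) euclideanreal (\<lambda>t. g t i)" for i
    by (cases "i = 0"; cases "i = Suc 0")
      (auto simp: g_def continuous_map_iff_continuous intro!: continuous_intros)
  ultimately show "pathin (nsphere n) g"
    by (auto simp: pathin_def nsphere continuous_map_in_subtopology continuous_map_componentwise_UNIV)
  show "g 0 = pole" "g 1 = antipode pole"
    by (auto simp: g_def pole_def antipode_def fun_eq_iff)
qed

text \<open>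
  A chain-level model of the hemispheres: the boundary of the \<open>k + 1\<close>-dimensional hemisphere is made
  of the \<open>k\<close>-dimensional one and its antipodal image.
\<close>
definition antipodal_tower :: "nat \<Rightarrow> nat \<Rightarrow> (nat \<Rightarrow> (nat \<Rightarrow> real) chain) \<Rightarrow> bool" where
  "antipodal_tower n N c \<longleftrightarrow>
     (\<forall>k\<le>N. singular_chain k (nsphere n) (c k)) \<and>
     c 0 = frag_of (restrict (\<lambda>_. pole) (standard_simplex 0)) \<and>
     (\<forall>k<N. chain_boundary (Suc k) (c (Suc k))
        = c k + frag_cmul ((-1) ^ Suc k) (chain_map k antipode (c k)))"

lemma chain_map_antipode_twice:
  assumes "singular_chain k (nsphere n) c"
  shows "chain_map k antipode (chain_map k antipode c) = c"
proof -
  have "chain_map k antipode (chain_map k antipode c) = chain_map k (antipode \<circ> antipode) c"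
    by (simp add: chain_map_compose)
  also have "antipode \<circ> antipode = id"
    by (auto simp: fun_eq_iff)
  finally show ?thesis
    using chain_map_id_gen[OF assms, of "\<lambda>a. a"] by simp
qed

text \<open>
  The chain that has to be filled in next is a cycle, because the antipodal map acts on the
  previous boundary as multiplication by the sign \<open>s\<close> and the signs alternate. In dimension \<open>0\<close>,
  where homology does not vanish, the filling is a path between the two points.
\<close>
lemma antipodal_tower_exists:
  assumes "N \<le> n"
  shows "\<exists>c. antipodal_tower n N c"
  using assms
proof (induction N)
  case 0
  have "singular_simplex 0 (nsphere n) (restrict (\<lambda>_. pole) (standard_simplex 0))"
    using pole_in_nsphere by (auto simp: singular_simplex_def)
  then show ?case
    by (intro exI[of _ "\<lambda>_. frag_of (restrict (\<lambda>_. pole) (standard_simplex 0))"])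
      (simp add: antipodal_tower_def singular_chain_of)
next
  case (Suc N)
  then obtain c where c: "antipodal_tower n N c" by auto
  define z where "z = c N + frag_cmul ((-1) ^ Suc N) (chain_map N antipode (c N))"
  have cN: "singular_chain k (nsphere n) (c k)" if "k \<le> N" for k
    using c that by (auto simp: antipodal_tower_def)
  have z: "singular_chain N (nsphere n) z"
    unfolding z_def
    by (intro singular_chain_add singular_chain_cmul singular_chain_chain_map[OF cN continuous_map_antipode] cN order.refl)
  have "\<exists>d. singular_chain (Suc N) (nsphere n) d \<and> chain_boundary (Suc N) d = z"
  proof (cases N)
    case 0
    obtain g where g: "pathin (nsphere n) g" "g 0 = pole" "g 1 = antipode pole"
      using antipodal_path[of n] Suc.prems by auto
    have "simplex_map 0 antipode (restrict (\<lambda>_. pole) (standard_simplex 0))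
        = restrict (\<lambda>_. antipode pole) (standard_simplex 0)"
      by (auto simp: simplex_map_def)
    then have "z = frag_of (restrict (\<lambda>_. g 0) (standard_simplex 0)) - frag_of (restrict (\<lambda>_. g 1) (standard_simplex 0))"
      using c by (simp add: z_def 0 g antipodal_tower_def)
    then show ?thesis
      using path_gives_chain[OF g(1)] 0 by simp
  next
    case (Suc M)
    define s :: int where "s = (-1) ^ Suc M"
    define w where "w = c M + frag_cmul s (chain_map M antipode (c M))"
    have s: "s * s = 1" "(-1) ^ Suc N = - s"
      by (simp_all add: s_def Suc flip: power_mult_distrib)
    have w: "chain_boundary N (c N) = w"
      using c by (simp add: antipodal_tower_def w_def s_def Suc)
    have Tw: "chain_map M antipode w = frag_cmul s w"
      using chain_map_antipode_twice[OF cN, of M]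
      by (simp add: w_def chain_map_add frag_cmul_distrib2 s Suc add.commute)
    have "chain_boundary N (chain_map N antipode (c N)) = chain_map M antipode w"
      using chain_boundary_chain_map[OF cN[OF order.refl], of antipode] by (simp add: Suc w[unfolded Suc])
    then have "chain_boundary N z = 0"
      unfolding z_def s(2) by (simp add: chain_boundary_add chain_boundary_cmul w Tw s)
    then show ?thesis
      using sphere_cycle_bounds[OF z] Suc Suc.prems by simp
  qed
  then obtain d where "singular_chain (Suc N) (nsphere n) d" "chain_boundary (Suc N) d = z" by blast
  then have "antipodal_tower n (Suc N) (c(Suc N := d))"
    using c by (auto simp: antipodal_tower_def z_def le_Suc_eq less_Suc_eq)
  then show ?case by blast
qed

lemma antipodal_tower_subdivision:
  assumes "antipodal_tower n N c"
  shows "antipodal_tower n N (\<lambda>k. singular_subdivision k (c k))"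
proof -
  have ch: "singular_chain k (nsphere n) (c k)" if "k \<le> N" for k
    using assms that by (auto simp: antipodal_tower_def)
  have "chain_boundary (Suc k) (singular_subdivision (Suc k) (c (Suc k))) =
     singular_subdivision k (c k) + frag_cmul ((-1) ^ Suc k) (chain_map k antipode (singular_subdivision k (c k)))"
    if "k < N" for k
  proof -
    have "chain_boundary (Suc k) (singular_subdivision (Suc k) (c (Suc k)))
        = singular_subdivision k (c k + frag_cmul ((-1) ^ Suc k) (chain_map k antipode (c k)))"
      using chain_boundary_singular_subdivision[OF ch[of "Suc k"]] assms that
      by (simp add: antipodal_tower_def)
    also have "\<dots> = singular_subdivision k (c k)
        + frag_cmul ((-1) ^ Suc k) (singular_subdivision k (chain_map k antipode (c k)))"
      by (simp only: singular_subdivision_def frag_extend_add frag_extend_cmul)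
    finally show ?thesis
      using naturality_singular_subdivision[OF ch[of k], of antipode] that by simp
  qed
  then show ?thesis
    using assms singular_subdivision_zero[OF ch[of 0]]
    by (auto simp: antipodal_tower_def singular_chain_singular_subdivision)
qed

lemma antipodal_tower_iterated_subdivision:
  assumes "antipodal_tower n N c"
  shows "antipodal_tower n N (\<lambda>k. (singular_subdivision k ^^ m) (c k))"
  by (induction m) (use assms antipodal_tower_subdivision in auto)

text \<open>The empty product evaluates to \<open>1\<close> on the point that starts the tower.\<close>
lemma odd_cup_on_tower:
  assumes c: "antipodal_tower n N c"
    and h: "\<And>j x. x \<in> topspace (nsphere n) \<Longrightarrow> h j (antipode x) = 1 - h j x"
    and "k \<le> N"
  shows "odd (chain_eval (cup_cochain h k) (c k))"
  using \<open>k \<le> N\<close>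
proof (induction k)
  case 0
  then show ?case
    using c by (simp add: antipodal_tower_def cup_cochain_def cup_diff_def)
next
  case (Suc k)
  show ?case
  proof (rule odd_pairing_step)
    show "chain_boundary (Suc k) (c (Suc k)) = c k + frag_cmul ((-1) ^ Suc k) (chain_map k antipode (c k))"
      using c Suc.prems by (simp add: antipodal_tower_def)
    show "odd (chain_eval (cup_cochain h k) (c k))"
      using Suc by simp
    fix \<sigma> j i assume \<sigma>: "\<sigma> \<in> Poly_Mapping.keys (c k)" and "i \<le> k"
    have "singular_simplex k (nsphere n) \<sigma>"
      using c Suc.prems \<sigma> by (auto simp: antipodal_tower_def singular_chain_def dest!: spec[of _ k])
    then have "vertex \<sigma> i \<in> topspace (nsphere n)"
      using \<open>i \<le> k\<close> by (auto simp: singular_simplex_def continuous_map_def vertex_def Pi_iff)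
    then show "h j (antipode (vertex \<sigma> i)) = 1 - h j (vertex \<sigma> i)"
      by (rule h)
  qed
qed

text \<open>
  If \<open>N \<le> n\<close>, then the tower has a chain of dimension \<open>N\<close>. After subdivision each of its simplices
  lies in an open set on which some \<open>f j\<close> is positive or negative throughout; there the \<open>j\<close>-th
  factor of the cup product vanishes, contradicting \<open>odd_cup_on_tower\<close>.
\<close>
theorem Borsuk_Ulam:
  fixes f :: "nat \<Rightarrow> (nat \<Rightarrow> real) \<Rightarrow> real"
  assumes cont: "\<And>i. i < N \<Longrightarrow> continuous_map (nsphere n) euclideanreal (f i)"
    and odd: "\<And>i x. i < N \<Longrightarrow> x \<in> topspace (nsphere n) \<Longrightarrow> f i (antipode x) = - f i x"
    and nz: "\<And>x. x \<in> topspace (nsphere n) \<Longrightarrow> \<exists>i<N. f i x \<noteq> 0"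
  shows "n < N"
proof (rule ccontr)
  assume "\<not> n < N"
  then obtain c where c: "antipodal_tower n N c"
    using antipodal_tower_exists[of N n] by auto
  \<comment> \<open>The sign of \<open>f j\<close>; at zeros of \<open>f j\<close>, and for \<open>j \<ge> N\<close>, the sign of the first nonzero coordinate
    is taken so that antipodal points always get different values.\<close>
  define h :: "nat \<Rightarrow> (nat \<Rightarrow> real) \<Rightarrow> int" where
    "h = (\<lambda>j x. of_bool (if j < N \<and> f j x \<noteq> 0 then 0 < f j x else 0 < x (LEAST i. x i \<noteq> 0)))"
  have h: "h j (antipode x) = 1 - h j x" if x: "x \<in> topspace (nsphere n)" for j x
  proof -
    have "\<exists>i. x i \<noteq> 0"
    proof (rule ccontr)
      assume "\<not> ?thesis"
      then have "(\<Sum>i\<le>n. (x i)\<^sup>2) = 0" by simp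
      then show False using x by (simp add: nsphere)
    qed
    then have "x (LEAST i. x i \<noteq> 0) \<noteq> 0"
      by (rule LeastI_ex)
    moreover have "(\<lambda>i. antipode x i \<noteq> 0) = (\<lambda>i. x i \<noteq> 0)"
      by (simp add: antipode_def)
    ultimately have "0 < antipode x (LEAST i. antipode x i \<noteq> 0) \<longleftrightarrow> \<not> 0 < x (LEAST i. x i \<noteq> 0)"
      by (auto simp: antipode_def)
    then show ?thesis
      using odd[of j x] x by (auto simp: h_def)
  qed
  define C where "C = (\<lambda>i. {x \<in> topspace (nsphere n). 0 < f i x}) ` {..<N}
     \<union> (\<lambda>i. {x \<in> topspace (nsphere n). f i x < 0}) ` {..<N}"
  have "openin (nsphere n) U" if "U \<in> C" for U
    using that openin_continuous_map_preimage[OF cont, of _ "{0<..}"]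
      openin_continuous_map_preimage[OF cont, of _ "{..<0}"] by (auto simp: C_def)
  moreover have "topspace (nsphere n) \<subseteq> \<Union>C"
  proof
    fix x assume x: "x \<in> topspace (nsphere n)"
    then obtain i where "i < N" "f i x > 0 \<or> f i x < 0"
      using nz by (metis linorder_neqE)
    then show "x \<in> \<Union>C" using x unfolding C_def by blast
  qed
  moreover have "singular_chain N (nsphere n) (c N)"
    using c by (simp add: antipodal_tower_def)
  ultimately obtain m where m: "\<And>\<sigma>. \<sigma> \<in> Poly_Mapping.keys ((singular_subdivision N ^^ m) (c N))
      \<Longrightarrow> \<exists>V\<in>C. \<sigma> \<in> standard_simplex N \<rightarrow> V"
    using sufficient_iterated_singular_subdivision_exists[of C "nsphere n" N "c N"] by (metis order.refl)
  have "cup_cochain h N \<sigma> = 0" if "\<sigma> \<in> Poly_Mapping.keys ((singular_subdivision N ^^ m) (c N))" for \<sigma>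
  proof -
    obtain V where V: "V \<in> C" "\<sigma> \<in> standard_simplex N \<rightarrow> V"
      using m[OF \<open>\<sigma> \<in> _\<close>] by blast
    have vertex_V: "vertex \<sigma> i \<in> V" if "i \<le> N" for i
      using V(2) that by (auto simp: vertex_def Pi_iff)
    obtain j where j: "j < N" "(\<forall>x\<in>V. f j x > 0) \<or> (\<forall>x\<in>V. f j x < 0)"
      using V(1) by (auto simp: C_def)
    then have "h j (vertex \<sigma> (Suc j)) = h j (vertex \<sigma> j)"
      using vertex_V[of j] vertex_V[of "Suc j"] by (auto simp: h_def)
    with j(1) have "\<exists>j<N. h j (vertex \<sigma> (Suc j)) - h j (vertex \<sigma> j) = 0"
      by (intro exI[of _ j]) simp
    then show ?thesis
      unfolding cup_cochain_def cup_diff_def by (intro prod_zero) auto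
  qed
  then have "chain_eval (cup_cochain h N) ((singular_subdivision N ^^ m) (c N)) = 0"
    by (simp add: chain_eval_def)
  moreover have "odd (chain_eval (cup_cochain h N) ((singular_subdivision N ^^ m) (c N)))"
    by (rule odd_cup_on_tower[OF antipodal_tower_iterated_subdivision[OF c] _ order.refl]) (rule h)
  ultimately show False by simp
qed

section \<open>Continuous maps from and into geometric realizations\<close>

lemma closed_closed_simplex:
  assumes "finite \<sigma>" shows "closed (closed_simplex \<sigma>)"
proof -
  have c: "continuous_on UNIV (\<lambda>u::'a \<Rightarrow> real. u v)" for v
    by (rule continuous_on_product_then_coordinatewise[OF continuous_on_id])
  have "closed_simplex \<sigma> = {u. \<forall>v. 0 \<le> u v} \<inter> {u. \<forall>v. v \<notin> \<sigma> \<longrightarrow> u v = 0} \<inter> {u. (\<Sum>v\<in>\<sigma>. u v) = 1}"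
    by (auto simp: closed_simplex_def)
  also have "closed \<dots>"
    by (intro closed_Int closed_Collect_all closed_Collect_imp open_Collect_const closed_Collect_le
        closed_Collect_eq continuous_intros c)
  finally show ?thesis .
qed

lemma openin_geom_realization_euclidean:
  "openin (geom_realization K) U \<longleftrightarrow> U \<subseteq> (\<Union>\<sigma>\<in>K. closed_simplex \<sigma>) \<and>
     (\<forall>\<sigma>\<in>K. openin (top_of_set (closed_simplex \<sigma>)) (U \<inter> closed_simplex \<sigma>))"
  by (simp add: openin_geom_realization euclidean_product_topology)

lemma closedin_geom_realization:
  assumes "\<And>\<sigma>. \<sigma> \<in> K \<Longrightarrow> finite \<sigma>"
  shows "closedin (geom_realization K) C \<longleftrightarrow> C \<subseteq> (\<Union>\<sigma>\<in>K. closed_simplex \<sigma>) \<and>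
     (\<forall>\<sigma>\<in>K. closed (C \<inter> closed_simplex \<sigma>))"
proof -
  let ?S = "\<Union>\<sigma>\<in>K. closed_simplex \<sigma>"
  have "openin (top_of_set (closed_simplex \<sigma>)) ((?S - C) \<inter> closed_simplex \<sigma>) \<longleftrightarrow> closed (C \<inter> closed_simplex \<sigma>)"
    if "\<sigma> \<in> K" for \<sigma>
  proof -
    have "(?S - C) \<inter> closed_simplex \<sigma> = closed_simplex \<sigma> - (C \<inter> closed_simplex \<sigma>)"
      using that by auto
    moreover have "closedin (top_of_set (closed_simplex \<sigma>)) (C \<inter> closed_simplex \<sigma>) \<longleftrightarrow> closed (C \<inter> closed_simplex \<sigma>)"
      using closed_closed_simplex[OF assms[OF that]]
      by (metis closedin_closed_eq closedin_closed_trans inf_le2 closed_subset)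
    ultimately show ?thesis
      by (simp add: closedin_def)
  qed
  then show ?thesis
    by (auto simp: closedin_def topspace_geom_realization openin_geom_realization_euclidean)
qed

lemma continuous_map_from_geom_realization:
  fixes g :: "('v \<Rightarrow> real) \<Rightarrow> real"
  assumes "\<And>\<sigma>. \<sigma> \<in> K \<Longrightarrow> continuous_on (closed_simplex \<sigma>) g"
  shows "continuous_map (geom_realization K) euclideanreal g"
  unfolding continuous_map_def
proof (intro conjI allI impI)
  fix U :: "real set" assume "openin euclideanreal U"
  then have U: "open U" by simp
  let ?P = "{u \<in> topspace (geom_realization K). g u \<in> U}"
  have "openin (top_of_set (closed_simplex \<sigma>)) (?P \<inter> closed_simplex \<sigma>)" if "\<sigma> \<in> K" for \<sigma>
  proof -
    have "?P \<inter> closed_simplex \<sigma> = closed_simplex \<sigma> \<inter> g -` U"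
      using that by (auto simp: topspace_geom_realization)
    then show ?thesis
      using continuous_openin_preimage_gen[OF assms[OF that] U] by simp
  qed
  then show "openin (geom_realization K) ?P"
    by (auto simp: openin_geom_realization_euclidean topspace_geom_realization)
qed auto

text \<open>
  The extension of a function on the vertices that is affine on every simplex; the sum is over the
  support of \<open>u\<close>, so that it does not mention a simplex containing \<open>u\<close>.
\<close>
definition affine_extension :: "('v \<Rightarrow> real) \<Rightarrow> ('v \<Rightarrow> real) \<Rightarrow> real" where
  "affine_extension s u = (\<Sum>v | u v \<noteq> 0. u v * s v)"

lemma affine_extension_simplex:
  assumes "finite \<sigma>" "u \<in> closed_simplex \<sigma>"
  shows "affine_extension s u = (\<Sum>v\<in>\<sigma>. u v * s v)"
  unfolding affine_extension_def using assms
  by (intro sum.mono_neutral_left) (auto simp: closed_simplex_def)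

lemma continuous_map_affine_extension:
  assumes "\<And>\<sigma>. \<sigma> \<in> K \<Longrightarrow> finite \<sigma>"
  shows "continuous_map (geom_realization K) euclideanreal (affine_extension s)"
proof (rule continuous_map_from_geom_realization)
  fix \<sigma> assume \<sigma>: "\<sigma> \<in> K"
  have c: "continuous_on A (\<lambda>u::'a \<Rightarrow> real. u v)" for v A
    by (rule continuous_on_product_then_coordinatewise[OF continuous_on_id])
  have "continuous_on (closed_simplex \<sigma>) (\<lambda>u. \<Sum>v\<in>\<sigma>. u v * s v)"
    by (intro continuous_intros c)
  then show "continuous_on (closed_simplex \<sigma>) (affine_extension s)"
    using affine_extension_simplex[OF assms[OF \<sigma>]] by (simp cong: continuous_on_cong)
qed

lemma continuous_map_coordinate:
  "continuous_map (geom_realization K) euclideanreal (\<lambda>u. u v)"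
  by (rule continuous_map_from_geom_realization)
    (rule continuous_on_product_then_coordinatewise[OF continuous_on_id])

text \<open>
  The weak topology is finer than the topology of coordinatewise convergence, but not on a
  finite subcomplex: a closed set meets it in finitely many closed subsets of simplices.
\<close>
lemma continuous_map_into_geom_realization:
  assumes "finite S"
    and coord: "\<And>v. continuous_map X euclideanreal (\<lambda>x. f x v)"
    and fin: "\<And>\<sigma>. \<sigma> \<in> K \<Longrightarrow> finite \<sigma>"
    and f: "\<And>x. x \<in> topspace X \<Longrightarrow> \<exists>\<sigma>\<in>K. \<sigma> \<subseteq> S \<and> f x \<in> closed_simplex \<sigma>"
  shows "continuous_map X (geom_realization K) f"
  unfolding continuous_map_closedin
proof (intro conjI allI impI ballI)
  show "f \<in> topspace X \<rightarrow> topspace (geom_realization K)"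
    using f by (fastforce simp: topspace_geom_realization)
  fix C assume C: "closedin (geom_realization K) C"
  have "continuous_map X (powertop_real UNIV) f"
    using coord by (simp add: continuous_map_componentwise_UNIV)
  then have cf: "continuous_map X euclidean f"
    by (simp add: euclidean_product_topology)
  have "closedin X {x \<in> topspace X. f x \<in> C \<inter> closed_simplex \<sigma>}" if "\<sigma> \<in> K" for \<sigma>
    using C that by (intro closedin_continuous_map_preimage[OF cf]) (simp add: closedin_geom_realization[OF fin])
  moreover have "{x \<in> topspace X. f x \<in> C}
      = (\<Union>\<sigma>\<in>K \<inter> Pow S. {x \<in> topspace X. f x \<in> C \<inter> closed_simplex \<sigma>})"
    using f by blast
  ultimately show "closedin X {x \<in> topspace X. f x \<in> C}"
    using \<open>finite S\<close> by (auto intro!: closedin_Union)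
qed

text \<open>
  If infinitely many supports occurred, choose one point of the image for each support. A simplex
  has finitely many faces, hence contains finitely many of the chosen points, so every set of
  chosen points is closed: the chosen points form an infinite closed discrete subset of a compact
  set.
\<close>
lemma compact_image_finite_support:
  fixes f :: "'a \<Rightarrow> 'v \<Rightarrow> real"
  assumes X: "compact_space X" and cont: "continuous_map X (geom_realization K) f"
    and fin: "\<And>\<sigma>. \<sigma> \<in> K \<Longrightarrow> finite \<sigma>"
  shows "finite {v. \<exists>x\<in>topspace X. f x v \<noteq> 0}"
proof -
  let ?Y = "geom_realization K"
  define supp where "supp = (\<lambda>u::'v \<Rightarrow> real. {v. u v \<noteq> 0})"
  define Q where "Q = f ` topspace X"
  have Q: "compactin ?Y Q"
    using image_compactin[OF _ cont] X by (simp add: Q_def compact_space_def)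
  have Q_simplex: "\<exists>\<sigma>\<in>K. u \<in> closed_simplex \<sigma>" if "u \<in> Q" for u
    using compactin_subset_topspace[OF Q] that by (auto simp: topspace_geom_realization)
  obtain D where D: "D \<subseteq> Q" "inj_on supp D" "supp ` D = supp ` Q"
    using subset_image_inj[of "supp ` Q" supp Q] by auto
  have closed: "closedin ?Y E" if "E \<subseteq> D" for E
  proof (subst closedin_geom_realization, rule fin, assumption, intro conjI ballI)
    show "E \<subseteq> (\<Union>\<sigma>\<in>K. closed_simplex \<sigma>)"
      using that D Q_simplex by auto
    fix \<sigma> assume \<sigma>: "\<sigma> \<in> K"
    have "supp ` (E \<inter> closed_simplex \<sigma>) \<subseteq> Pow \<sigma>"
      by (auto simp: supp_def closed_simplex_def)
    then have "finite (supp ` (E \<inter> closed_simplex \<sigma>))"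
      using fin[OF \<sigma>] by (meson finite_Pow_iff finite_subset)
    moreover have "inj_on supp (E \<inter> closed_simplex \<sigma>)"
      using D(2) that by (meson inf_le1 inj_on_subset subset_trans)
    ultimately have "finite (E \<inter> closed_simplex \<sigma>)"
      by (simp add: finite_image_iff)
    moreover have "t1_space (powertop_real (UNIV :: 'v set))"
      by (simp add: t1_space_product_topology t1_space_euclidean)
    ultimately show "closed (E \<inter> closed_simplex \<sigma>)"
      by (simp add: t1_space_closedin_finite euclidean_product_topology)
  qed
  have "?Y derived_set_of D = {}"
  proof (rule ccontr)
    assume "?Y derived_set_of D \<noteq> {}"
    then obtain u where u: "u \<in> ?Y derived_set_of D" by blast
    then have "u \<in> ?Y derived_set_of (D - {u})"
      by (auto simp: in_derived_set_of)
    then have "u \<in> D - {u}"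
      using closed[of "D - {u}"] closedin_contains_derived_set by (metis Diff_subset subsetD)
    then show False by simp
  qed
  then have "finite D"
    using compactin_imp_Bolzano_Weierstrass[OF Q, of D] D(1) by auto
  then have "finite (supp ` Q)"
    using D(3) by (metis finite_imageI)
  moreover have "finite (supp u)" if "u \<in> Q" for u
  proof -
    obtain \<sigma> where "\<sigma> \<in> K" "u \<in> closed_simplex \<sigma>" using Q_simplex[OF \<open>u \<in> Q\<close>] by blast
    then show ?thesis
      using fin[of \<sigma>] by (auto simp: supp_def closed_simplex_def intro: finite_subset)
  qed
  ultimately have "finite (\<Union>(supp ` Q))" by auto
  moreover have "{v. \<exists>x\<in>topspace X. f x v \<noteq> 0} = \<Union>(supp ` Q)"
    by (auto simp: supp_def Q_def)
  ultimately show ?thesis by simp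
qed

section \<open>Spheres, odd maps and the coindex\<close>

lemma compact_space_nsphere: "compact_space (nsphere n)"
proof -
  let ?B = "(UNIV :: nat set) \<rightarrow>\<^sub>E {-1..1::real}"
  have "compactin (powertop_real UNIV) ?B"
    by (simp add: compactin_PiE)
  moreover have "closedin (powertop_real UNIV) (topspace (nsphere n))"
  proof -
    have c: "continuous_on UNIV (\<lambda>u::nat \<Rightarrow> real. u v)" for v
      by (rule continuous_on_product_then_coordinatewise[OF continuous_on_id])
    have "closed {x::nat \<Rightarrow> real. (\<Sum>i\<le>n. (x i)\<^sup>2) = 1 \<and> (\<forall>i. i > n \<longrightarrow> x i = 0)}"
      by (intro closed_Collect_conj closed_Collect_all closed_Collect_imp open_Collect_const
          closed_Collect_eq continuous_intros c)
    then show ?thesis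
      by (simp add: nsphere euclidean_product_topology Collect_conj_eq)
  qed
  moreover have "topspace (nsphere n) \<subseteq> ?B"
  proof
    fix x assume x: "x \<in> topspace (nsphere n)"
    have "\<bar>x i\<bar> \<le> 1" for i
    proof (cases "i \<le> n")
      case True
      then have "(x i)\<^sup>2 \<le> (\<Sum>i\<le>n. (x i)\<^sup>2)"
        by (intro member_le_sum) auto
      then show ?thesis using x by (simp add: nsphere abs_square_le_1)
    qed (use x in \<open>auto simp: nsphere\<close>)
    then show "x \<in> ?B" by (auto simp: abs_le_iff)
  qed
  ultimately have "compactin (powertop_real UNIV) (topspace (nsphere n))"
    by (metis closed_compactin)
  then show ?thesis
    by (simp add: nsphere compact_space_subtopology)
qed

definition odd_map :: "nat \<Rightarrow> 'a topology \<Rightarrow> ('a \<Rightarrow> 'a) \<Rightarrow> ((nat \<Rightarrow> real) \<Rightarrow> 'a) \<Rightarrow> bool" where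
  "odd_map n X \<tau> f \<longleftrightarrow> continuous_map (nsphere n) X f \<and>
     (\<forall>x\<in>topspace (nsphere n). f (antipode x) = \<tau> (f x))"

lemma nsphere_subset:
  assumes "n \<le> k" shows "continuous_map (nsphere n) (nsphere k) (\<lambda>x. x)"
proof -
  have "(\<Sum>i\<le>k. (x i)\<^sup>2) = (\<Sum>i\<le>n. (x i)\<^sup>2)" if "\<forall>i>n. x i = 0" for x :: "nat \<Rightarrow> real"
    using assms that by (intro sum.mono_neutral_right) auto
  then have "topspace (nsphere n) \<subseteq> topspace (nsphere k)"
    using assms by (auto simp: nsphere)
  moreover have "continuous_map (nsphere n) (powertop_real UNIV) (\<lambda>x. x)"
    by (simp add: nsphere)
  ultimately show ?thesis
    by (subst (2) nsphere) (auto simp: continuous_map_in_subtopology nsphere)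
qed

lemma odd_map_restrict:
  assumes "odd_map k X \<tau> f" "n \<le> k" shows "odd_map n X \<tau> f"
proof -
  have "continuous_map (nsphere n) X (f \<circ> (\<lambda>x. x))"
    using nsphere_subset[OF assms(2)] assms(1) by (auto simp: odd_map_def intro: continuous_map_compose)
  moreover have "topspace (nsphere n) \<subseteq> topspace (nsphere k)"
    using nsphere_subset[OF assms(2)] by (auto simp: continuous_map_def)
  ultimately show ?thesis
    using assms(1) by (auto simp: odd_map_def o_def)
qed

text \<open>
  For \<open>n = 0\<close> the left-hand side always holds, whereas the right-hand side fails for an empty \<open>X\<close>.
\<close>
lemma coind_ge_iff:
  assumes "0 < n"
  shows "enat n \<le> coind X \<tau> \<longleftrightarrow> (\<exists>f. odd_map n X \<tau> f)"
proof
  assume le: "enat n \<le> coind X \<tau>"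
  have "\<exists>k\<ge>n. \<exists>f. odd_map k X \<tau> f"
  proof (rule ccontr)
    assume "\<not> ?thesis"
    then have "coind X \<tau> \<le> enat (n - 1)"
      unfolding coind_def
    proof (intro Sup_least, elim CollectE exE conjE)
      fix x k f assume "x = enat k" "continuous_map (nsphere k) X f"
        "\<forall>x\<in>topspace (nsphere k). f (antipode x) = \<tau> (f x)"
      then have "odd_map k X \<tau> f" by (simp add: odd_map_def)
      then have "k < n" using \<open>\<not> (\<exists>k\<ge>n. \<exists>f. odd_map k X \<tau> f)\<close> by (meson not_le)
      then show "x \<le> enat (n - 1)" using \<open>x = enat k\<close> by simp
    qed
    with le have "enat n \<le> enat (n - 1)" by (rule order.trans)
    with assms show False by simp
  qed
  then show "\<exists>f. odd_map n X \<tau> f" using odd_map_restrict by blast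
next
  assume "\<exists>f. odd_map n X \<tau> f"
  then show "enat n \<le> coind X \<tau>"
    unfolding coind_def odd_map_def by (intro Sup_upper) blast
qed

abbreviation dot :: "nat \<Rightarrow> (nat \<Rightarrow> real) \<Rightarrow> (nat \<Rightarrow> real) \<Rightarrow> real" where
  "dot m x y \<equiv> (\<Sum>i\<le>m. x i * y i)"

lemma dot_self: "x \<in> topspace (nsphere m) \<Longrightarrow> dot m x x = 1"
  by (simp add: nsphere power2_eq_square)

lemma dot_polarization:
  assumes "x \<in> topspace (nsphere m)" "y \<in> topspace (nsphere m)"
  shows "(\<Sum>i\<le>m. (x i - y i)\<^sup>2) = 2 - 2 * dot m x y"
  using dot_self[OF assms(1)] dot_self[OF assms(2)]
  by (simp add: power2_eq_square algebra_simps sum.distrib sum_subtractf sum_distrib_left)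

lemma dot_antipode: "dot m (antipode x) y = - dot m x y" "dot m x (antipode y) = - dot m x y"
  by (simp_all add: antipode_def sum_negf)

lemma dot_le_1:
  assumes "x \<in> topspace (nsphere m)" "y \<in> topspace (nsphere m)"
  shows "dot m x y \<le> 1"
proof -
  have "0 \<le> (\<Sum>i\<le>m. (x i - y i)\<^sup>2)" by (intro sum_nonneg) simp
  then show ?thesis using dot_polarization[OF assms] by simp
qed

lemma dot_ge_minus_1:
  assumes "x \<in> topspace (nsphere m)" "y \<in> topspace (nsphere m)"
  shows "- 1 \<le> dot m x y"
  using dot_le_1[of "antipode x" m y] assms by (simp add: dot_antipode)

lemma sphere_dist_le_iff:
  assumes "x \<in> topspace (nsphere m)" "y \<in> topspace (nsphere m)" "0 \<le> r" "r \<le> pi"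
  shows "sphere_dist m x y \<le> r \<longleftrightarrow> cos r \<le> dot m x y"
proof -
  have "dot m x y = cos (sphere_dist m x y)"
    using dot_le_1[OF assms(1,2)] dot_ge_minus_1[OF assms(1,2)] by (simp add: sphere_dist_def)
  moreover have "0 \<le> sphere_dist m x y" "sphere_dist m x y \<le> pi"
    using dot_le_1[OF assms(1,2)] dot_ge_minus_1[OF assms(1,2)]
    by (simp_all add: sphere_dist_def arccos_lbound arccos_ubound)
  ultimately show ?thesis
    using assms by (simp add: cos_mono_le_eq)
qed

text \<open>
  Closeness of points is measured coordinatewise; the factor \<open>2\<close> in front of \<open>\<delta>\<close> allows the lemma to
  be applied to two points that are both \<open>\<delta>\<close>-close to a third one.
\<close>
lemma close_coordinates_dot:
  assumes "c < 1"
  shows "\<exists>\<delta>>0. \<forall>x\<in>topspace (nsphere m). \<forall>y\<in>topspace (nsphere m).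
     (\<forall>i\<le>m. \<bar>x i - y i\<bar> \<le> 2 * \<delta>) \<longrightarrow> c < dot m x y"
proof (intro exI conjI ballI impI)
  define \<delta> where "\<delta> = sqrt ((1 - c) / (4 * real (Suc m)))"
  show "0 < \<delta>" using assms by (simp add: \<delta>_def)
  fix x y assume xy: "x \<in> topspace (nsphere m)" "y \<in> topspace (nsphere m)"
    and close: "\<forall>i\<le>m. \<bar>x i - y i\<bar> \<le> 2 * \<delta>"
  have "(\<Sum>i\<le>m. (x i - y i)\<^sup>2) \<le> (\<Sum>i\<le>m. (2 * \<delta>)\<^sup>2)"
    using close \<open>0 < \<delta>\<close> by (intro sum_mono abs_le_square_iff[THEN iffD1]) auto
  also have "\<dots> = 1 - c"
    using assms by (simp add: \<delta>_def power_mult_distrib field_simps)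
  finally show "c < dot m x y"
    using dot_polarization[OF xy] assms by simp
qed

lemma finite_net_nsphere:
  assumes "0 < \<delta>"
  obtains P where "finite P" "P \<subseteq> topspace (nsphere m)"
    "\<And>x. x \<in> topspace (nsphere m) \<Longrightarrow> \<exists>p\<in>P. \<forall>i\<le>m. \<bar>x i - p i\<bar> < \<delta>"
proof -
  let ?S = "topspace (nsphere m)"
  define U where "U = (\<lambda>p. {x \<in> ?S. \<forall>i\<le>m. \<bar>x i - p i\<bar> < \<delta>})"
  have "openin (nsphere m) (U p)" for p
  proof -
    have "openin (nsphere m) {x \<in> ?S. x i \<in> ball (p i) \<delta>}" for i
      by (intro openin_continuous_map_preimage[OF continuous_map_nsphere_projection]) auto
    then have "openin (nsphere m) (\<Inter>i\<le>m. {x \<in> ?S. x i \<in> ball (p i) \<delta>})"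
      by (intro openin_Inter) auto
    also have "(\<Inter>i\<le>m. {x \<in> ?S. x i \<in> ball (p i) \<delta>}) = U p"
      by (auto simp: U_def dist_real_def abs_minus_commute)
    finally show ?thesis .
  qed
  moreover have "?S \<subseteq> \<Union>(U ` ?S)"
    using assms by (auto simp: U_def)
  ultimately obtain F where F: "finite F" "F \<subseteq> U ` ?S" "?S \<subseteq> \<Union>F"
    using compact_space_nsphere[of m] unfolding compact_space_alt by (metis (no_types, lifting) imageE)
  then obtain P where P: "finite P" "P \<subseteq> ?S" "F = U ` P"
    by (metis finite_subset_image)
  show thesis
  proof
    show "\<exists>p\<in>P. \<forall>i\<le>m. \<bar>x i - p i\<bar> < \<delta>" if "x \<in> ?S" for x
      using F(3) P(3) that by (auto simp: U_def)
  qed (use P in auto)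
qed

section \<open>Upper bounds on the coindex\<close>

abbreviation sphere_simplices :: "nat \<Rightarrow> real \<Rightarrow> (nat \<Rightarrow> real) set set" where
  "sphere_simplices m r \<equiv> VR_simplices (topspace (nsphere m)) (sphere_dist m) r"

lemma finite_simplex: "\<sigma> \<in> VR_simplices V d r \<Longrightarrow> finite \<sigma>"
  by (simp add: VR_simplices_def)

lemma sphere_simplices_iff:
  assumes "0 \<le> r" "r \<le> pi"
  shows "\<sigma> \<in> sphere_simplices m r \<longleftrightarrow> \<sigma> \<subseteq> topspace (nsphere m) \<and> finite \<sigma> \<and> \<sigma> \<noteq> {} \<and>
     (\<forall>x\<in>\<sigma>. \<forall>y\<in>\<sigma>. cos r \<le> dot m x y)"
proof -
  have "(\<forall>x\<in>\<sigma>. \<forall>y\<in>\<sigma>. sphere_dist m x y \<le> r) \<longleftrightarrow> (\<forall>x\<in>\<sigma>. \<forall>y\<in>\<sigma>. cos r \<le> dot m x y)"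
    if "\<sigma> \<subseteq> topspace (nsphere m)"
    using that assms by (intro ball_cong refl sphere_dist_le_iff) auto
  then show ?thesis
    unfolding VR_simplices_def using diam_le_iff[of \<sigma> "sphere_dist m" r] by blast
qed

abbreviation odd_map_VR :: "nat \<Rightarrow> nat \<Rightarrow> real \<Rightarrow> ((nat \<Rightarrow> real) \<Rightarrow> (nat \<Rightarrow> real) \<Rightarrow> real) \<Rightarrow> bool" where
  "odd_map_VR n m r \<equiv> odd_map n (VR_sphere m r) VR_antipode"

lemma odd_map_VR_mono:
  assumes "odd_map_VR n m r f" "r \<le> r'"
  shows "odd_map_VR n m r' f"
proof -
  let ?K = "sphere_simplices m r" and ?K' = "sphere_simplices m r'"
  have sub: "?K \<subseteq> ?K'"
    using assms(2) by (auto simp: VR_simplices_def)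
  have "continuous_map (geom_realization ?K) (geom_realization ?K') (\<lambda>u. u)"
    unfolding continuous_map_def
  proof (intro conjI allI impI)
    show "(\<lambda>u. u) \<in> topspace (geom_realization ?K) \<rightarrow> topspace (geom_realization ?K')"
      using sub by (auto simp: topspace_geom_realization)
    fix U assume U: "openin (geom_realization ?K') U"
    have "{u \<in> topspace (geom_realization ?K). u \<in> U} \<inter> closed_simplex \<sigma> = U \<inter> closed_simplex \<sigma>"
      if "\<sigma> \<in> ?K" for \<sigma>
      using that by (auto simp: topspace_geom_realization)
    then show "openin (geom_realization ?K) {u \<in> topspace (geom_realization ?K). u \<in> U}"
      using U sub by (auto simp: openin_geom_realization topspace_geom_realization)
  qed
  then have "continuous_map (nsphere n) (VR_sphere m r') ((\<lambda>u. u) \<circ> f)"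
    using assms(1) by (auto simp: odd_map_def VR_sphere_def VR_def intro: continuous_map_compose)
  then show ?thesis
    using assms(1) by (simp add: odd_map_def o_def)
qed

lemma affine_extension_VR_antipode:
  assumes "\<And>x. s (antipode x) = - s x"
  shows "affine_extension s (VR_antipode u) = - affine_extension s u"
proof -
  have "affine_extension s (VR_antipode u) = (\<Sum>v | u v \<noteq> 0. u v * s (antipode v))"
    unfolding affine_extension_def VR_antipode_def
    by (rule sum.reindex_bij_witness[of _ antipode antipode]) auto
  then show ?thesis
    by (simp add: assms affine_extension_def sum_negf)
qed

text \<open>
  Odd functions of the vertices extend affinely to odd functions on the complex, to whose
  composites with \<open>f\<close> the Borsuk--Ulam theorem applies. In the weak topology the
  affine extension of an arbitrary function is continuous, even that of an indicator function.
\<close>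
lemma odd_map_VR_dimension_bound:
  fixes s :: "'i \<Rightarrow> (nat \<Rightarrow> real) \<Rightarrow> real"
  assumes "finite I" and odd: "\<And>i x. i \<in> I \<Longrightarrow> s i (antipode x) = - s i x"
    and nz: "\<And>\<sigma> u. \<sigma> \<in> sphere_simplices m r \<Longrightarrow> u \<in> closed_simplex \<sigma> \<Longrightarrow> \<exists>i\<in>I. (\<Sum>x\<in>\<sigma>. u x * s i x) \<noteq> 0"
    and f: "odd_map_VR n m r f"
  shows "n < card I"
proof -
  obtain b where b: "bij_betw b {0..<card I} I"
    using ex_bij_betw_nat_finite[OF \<open>finite I\<close>] by blast
  have bI: "b i \<in> I" if "i < card I" for i
    using b that by (auto simp: bij_betw_def)
  show ?thesis
  proof (rule Borsuk_Ulam)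
    fix i assume i: "i < card I"
    have "continuous_map (nsphere n) euclideanreal (affine_extension (s (b i)) \<circ> f)"
      using f by (intro continuous_map_compose[of _ "VR_sphere m r"])
        (auto simp: odd_map_def VR_sphere_def VR_def intro: continuous_map_affine_extension finite_simplex)
    then show "continuous_map (nsphere n) euclideanreal (\<lambda>x. affine_extension (s (b i)) (f x))"
      by (simp add: o_def)
    show "affine_extension (s (b i)) (f (antipode x)) = - affine_extension (s (b i)) (f x)"
      if "x \<in> topspace (nsphere n)" for x
      using f that odd[OF bI[OF i]] by (simp add: odd_map_def affine_extension_VR_antipode)
  next
    fix x assume "x \<in> topspace (nsphere n)"
    then have "f x \<in> topspace (VR_sphere m r)"
      using f by (auto simp: odd_map_def continuous_map_def)
    then obtain \<sigma> where \<sigma>: "\<sigma> \<in> sphere_simplices m r" "f x \<in> closed_simplex \<sigma>"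
      by (auto simp: VR_sphere_def VR_def topspace_geom_realization)
    obtain i where i: "i \<in> I" "(\<Sum>v\<in>\<sigma>. f x v * s i v) \<noteq> 0"
      using nz[OF \<sigma>] by blast
    moreover obtain j where "j < card I" "i = b j"
      using b i(1) by (metis atLeastLessThan_iff bij_betw_imp_surj_on imageE)
    ultimately show "\<exists>j<card I. affine_extension (s (b j)) (f x) \<noteq> 0"
      using affine_extension_simplex[OF finite_simplex[OF \<sigma>(1)] \<sigma>(2)] by auto
  qed
qed

text \<open>
  At scales below \<open>\<pi> / 2\<close> the vertices of a simplex have pairwise positive inner products, so a
  convex combination of them has a positive inner product with each vertex and is nonzero; the odd
  functions are its coordinates.
\<close>
lemma odd_map_VR_small_scale:
  assumes f: "odd_map_VR n m r f" and r: "0 \<le> r" "r < pi / 2"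
  shows "n \<le> m"
proof -
  have "n < card {..m}"
  proof (rule odd_map_VR_dimension_bound[OF _ _ _ f])
    fix \<sigma> u assume \<sigma>: "\<sigma> \<in> sphere_simplices m r" and u: "u \<in> closed_simplex \<sigma>"
    have \<sigma>': "finite \<sigma>" "\<sigma> \<noteq> {}" "\<And>x y. x \<in> \<sigma> \<Longrightarrow> y \<in> \<sigma> \<Longrightarrow> cos r \<le> dot m x y"
      using \<sigma> sphere_simplices_iff[of r \<sigma> m] r by auto
    obtain y where y: "y \<in> \<sigma>" using \<sigma>'(2) by blast
    have "0 < cos r" using r by (intro cos_gt_zero_pi) auto
    also have "cos r = (\<Sum>x\<in>\<sigma>. u x * cos r)"
      using u by (simp add: closed_simplex_def flip: sum_distrib_right)
    also have "\<dots> \<le> (\<Sum>x\<in>\<sigma>. u x * dot m x y)"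
      using \<sigma>'(3) y u by (intro sum_mono mult_left_mono) (auto simp: closed_simplex_def)
    also have "\<dots> = (\<Sum>i\<le>m. (\<Sum>x\<in>\<sigma>. u x * x i) * y i)"
      by (simp add: sum_distrib_left sum_distrib_right mult.assoc sum.swap[of _ \<sigma>])
    finally show "\<exists>i\<in>{..m}. (\<Sum>x\<in>\<sigma>. u x * x i) \<noteq> 0"
      by (metis (no_types, lifting) less_irrefl mult_zero_left sum.neutral)
  qed (auto simp: antipode_def)
  then show ?thesis by simp
qed

text \<open>
  The odd function belonging to a net point \<open>p\<close> is the indicator of a neighbourhood of \<open>p\<close> minus that
  of the antipodal neighbourhood. If \<open>p\<close> is near a vertex of positive weight, then no
  vertex of the simplex lies in the antipodal neighbourhood, as its distance from that vertex would
  exceed \<open>r\<close>; so only nonnegative terms remain.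
\<close>
lemma odd_map_VR_bounded:
  assumes r: "0 \<le> r" "r < pi"
  obtains b where "\<And>n f. odd_map_VR n m r f \<Longrightarrow> n < b"
proof -
  let ?S = "topspace (nsphere m)"
  have "- cos r < 1"
    using cos_monotone_0_pi[of r pi] r by simp
  then obtain \<delta> where \<delta>: "0 < \<delta>" "\<And>x y. x \<in> ?S \<Longrightarrow> y \<in> ?S \<Longrightarrow> \<forall>i\<le>m. \<bar>x i - y i\<bar> \<le> 2 * \<delta> \<Longrightarrow> - cos r < dot m x y"
    using close_coordinates_dot[of "- cos r" m] by blast
  obtain P where P: "finite P" "P \<subseteq> ?S" "\<And>x. x \<in> ?S \<Longrightarrow> \<exists>p\<in>P. \<forall>i\<le>m. \<bar>x i - p i\<bar> < \<delta>"
    using finite_net_nsphere[OF \<delta>(1), of m] by blast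
  define near where "near = (\<lambda>p x. \<forall>i\<le>m. \<bar>x i - p i\<bar> < \<delta>)"
  define s :: "(nat \<Rightarrow> real) \<Rightarrow> (nat \<Rightarrow> real) \<Rightarrow> real"
    where "s = (\<lambda>p x. of_bool (near p x) - of_bool (near p (antipode x)))"
  have "n < card P" if f: "odd_map_VR n m r f" for n f
  proof (rule odd_map_VR_dimension_bound[OF P(1) _ _ f])
    show "s p (antipode x) = - s p x" for p x
      by (simp add: s_def)
    fix \<sigma> u assume \<sigma>: "\<sigma> \<in> sphere_simplices m r" and u: "u \<in> closed_simplex \<sigma>"
    have \<sigma>': "finite \<sigma>" "\<sigma> \<subseteq> ?S" "\<And>x y. x \<in> \<sigma> \<Longrightarrow> y \<in> \<sigma> \<Longrightarrow> cos r \<le> dot m x y"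
      using \<sigma> sphere_simplices_iff[of r \<sigma> m] r by auto
    have "\<exists>y\<in>\<sigma>. u y \<noteq> 0"
      using u by (metis (mono_tags, lifting) closed_simplex_def mem_Collect_eq sum.neutral zero_neq_one)
    then obtain y where y: "y \<in> \<sigma>" "u y > 0"
      using u by (auto simp: closed_simplex_def less_le)
    obtain p where p: "p \<in> P" "near p y"
      using P(3)[of y] \<sigma>'(2) y(1) unfolding near_def by blast
    have far: "\<not> near p (antipode x)" if "x \<in> \<sigma>" for x
    proof
      assume "near p (antipode x)"
      then have "\<bar>y i - antipode x i\<bar> \<le> 2 * \<delta>" if "i \<le> m" for i
        using p(2) that unfolding near_def by (smt (verit))
      then have "- cos r < dot m y (antipode x)"
        using \<sigma>'(2) y(1) that by (intro \<delta>(2)) auto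
      then show False
        using \<sigma>'(3)[OF y(1) that] by (simp add: dot_antipode)
    qed
    have "0 < u y * s p y"
      using y far p by (simp add: s_def)
    also have "\<dots> \<le> (\<Sum>x\<in>\<sigma>. u x * s p x)"
      using far u \<sigma>'(1) y(1) by (intro member_le_sum) (auto simp: s_def closed_simplex_def)
    finally show "\<exists>p\<in>P. (\<Sum>x\<in>\<sigma>. u x * s p x) \<noteq> 0"
      using p(1) by force
  qed
  then show thesis by (rule that)
qed

section \<open>Odd maps from a sphere to its own complexes\<close>

text \<open>
  A partition of unity on a finite net sends a point to a convex combination of the net points
  near it. The net is closed under antipodes and the weights \<open>w\<close> are invariant, which makes the map odd;
  finiteness of the net makes it continuous in the weak topology.
\<close>
lemma odd_map_VR_self:
  assumes "0 < r"
  shows "\<exists>f. odd_map_VR m m r f"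
proof -
  let ?S = "topspace (nsphere m)"
  define r' where "r' = min r pi"
  have r': "0 < r'" "r' \<le> pi" "r' \<le> r" using assms by (auto simp: r'_def)
  have "cos r' < 1"
    using cos_monotone_0_pi[of 0 r'] r' by simp
  then obtain \<delta> where \<delta>: "0 < \<delta>" "\<And>x y. x \<in> ?S \<Longrightarrow> y \<in> ?S \<Longrightarrow> \<forall>i\<le>m. \<bar>x i - y i\<bar> \<le> 2 * \<delta> \<Longrightarrow> cos r' < dot m x y"
    using close_coordinates_dot[of "cos r'" m] by blast
  obtain P0 where P0: "finite P0" "P0 \<subseteq> ?S" "\<And>x. x \<in> ?S \<Longrightarrow> \<exists>p\<in>P0. \<forall>i\<le>m. \<bar>x i - p i\<bar> < \<delta>"
    using finite_net_nsphere[OF \<delta>(1), of m] by blast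
  define P where "P = P0 \<union> antipode ` P0"
  have P: "finite P" "P \<subseteq> ?S" using P0 by (auto simp: P_def)
  have P_antipode: "antipode p \<in> P \<longleftrightarrow> p \<in> P" for p
    unfolding P_def by (metis Un_iff antipode_antipode image_iff)
  define w where "w = (\<lambda>p x. \<Prod>i\<le>m. max 0 (\<delta> - \<bar>x i - p i\<bar>))"
  define W where "W = (\<lambda>x. \<Sum>p\<in>P. w p x)"
  define f where "f = (\<lambda>x v. if v \<in> P then w v x / W x else 0)"
  have w_nonneg: "0 \<le> w p x" for p x by (simp add: w_def prod_nonneg)
  have w_pos: "w p x \<noteq> 0 \<longleftrightarrow> (\<forall>i\<le>m. \<bar>x i - p i\<bar> < \<delta>)" for p x
  proof -
    have "w p x \<noteq> 0 \<longleftrightarrow> (\<forall>i\<in>{..m}. max 0 (\<delta> - \<bar>x i - p i\<bar>) \<noteq> 0)"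
      by (simp add: w_def)
    moreover have "max 0 (\<delta> - a) \<noteq> 0 \<longleftrightarrow> a < \<delta>" for a :: real by auto
    ultimately show ?thesis by auto
  qed
  have W_pos: "0 < W x" if x: "x \<in> ?S" for x
  proof -
    obtain p where p: "p \<in> P" "w p x \<noteq> 0"
      using P0(3)[OF x] w_pos by (auto simp: P_def)
    then have "0 < w p x" using w_nonneg[of p x] by simp
    also have "\<dots> \<le> W x"
      unfolding W_def using P(1) p(1) w_nonneg by (intro member_le_sum) auto
    finally show ?thesis .
  qed
  have w_antipode: "w (antipode p) (antipode x) = w p x" for p x
    by (simp add: w_def antipode_def abs_minus_commute)
  have W_antipode: "W (antipode x) = W x" for x
    unfolding W_def
    by (rule sum.reindex_bij_witness[of _ antipode antipode]) (auto simp: P_antipode w_antipode[of "antipode _", simplified] w_antipode)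
  have cw: "continuous_map (nsphere m) euclideanreal (w p)" for p
    unfolding w_def by (intro continuous_intros continuous_map_nsphere_projection) auto
  have cW: "continuous_map (nsphere m) euclideanreal W"
    unfolding W_def by (intro continuous_map_sum cw P(1))
  have "continuous_map (nsphere m) (VR_sphere m r') f"
    unfolding VR_sphere_def VR_def
  proof (rule continuous_map_into_geom_realization[OF P(1)])
    show "continuous_map (nsphere m) euclideanreal (\<lambda>x. f x v)" for v
    proof (cases "v \<in> P")
      case True
      then show ?thesis
        unfolding f_def by (simp, intro continuous_map_real_divide cw cW) (use W_pos in force)
    qed (simp add: f_def)
    show "finite \<sigma>" if "\<sigma> \<in> sphere_simplices m r'" for \<sigma>
      using that by (rule finite_simplex)
    fix x assume x: "x \<in> ?S"
    define \<sigma> where "\<sigma> = {p \<in> P. w p x \<noteq> 0}"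
    have fin: "finite \<sigma>" "\<sigma> \<subseteq> ?S" using P by (auto simp: \<sigma>_def)
    have "(\<Sum>p\<in>\<sigma>. w p x) = W x"
      unfolding W_def \<sigma>_def using P(1) by (intro sum.mono_neutral_left) auto
    then have "(\<Sum>p\<in>\<sigma>. f x p) = 1"
      using W_pos[OF x] by (simp add: f_def \<sigma>_def flip: sum_divide_distrib)
    then have "f x \<in> closed_simplex \<sigma>"
      using W_pos[OF x] w_nonneg by (auto simp: closed_simplex_def f_def \<sigma>_def)
    moreover have "\<sigma> \<in> sphere_simplices m r'"
    proof -
      have "\<sigma> \<noteq> {}" using \<open>(\<Sum>p\<in>\<sigma>. f x p) = 1\<close> by auto
      moreover have "cos r' \<le> dot m p q" if "p \<in> \<sigma>" "q \<in> \<sigma>" for p q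
      proof -
        have "\<bar>p i - q i\<bar> \<le> 2 * \<delta>" if "i \<le> m" for i
          using \<open>p \<in> \<sigma>\<close> \<open>q \<in> \<sigma>\<close> that unfolding \<sigma>_def mem_Collect_eq w_pos by (smt (verit))
        then show ?thesis
          using \<delta>(2)[of p q] that fin(2) by fastforce
      qed
      ultimately show ?thesis
        using fin r' by (simp add: sphere_simplices_iff)
    qed
    moreover have "\<sigma> \<subseteq> P" by (auto simp: \<sigma>_def)
    ultimately show "\<exists>\<sigma>\<in>sphere_simplices m r'. \<sigma> \<subseteq> P \<and> f x \<in> closed_simplex \<sigma>"
      by blast
  qed
  moreover have "f (antipode x) = VR_antipode (f x)" for x
  proof
    fix v
    show "f (antipode x) v = VR_antipode (f x) v"
      using w_antipode[of "antipode v" x] by (simp add: f_def VR_antipode_def P_antipode W_antipode)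
  qed
  ultimately have "odd_map_VR m m r' f"
    by (simp add: odd_map_def)
  then show ?thesis
    using odd_map_VR_mono r'(3) by blast
qed

text \<open>
  At scale \<open>\<pi>\<close> antipodal points span a simplex, whose midpoint is fixed by the involution. This
  shows that the infimum in \<open>c_VR\<close> is over a nonempty set.
\<close>
lemma odd_map_VR_pi: "\<exists>f. odd_map_VR n m pi f"
proof -
  define u where "u = (\<lambda>v. if v = pole \<or> v = antipode pole then 1 / 2 else (0::real))"
  let ?\<sigma> = "{pole, antipode pole}"
  have ne: "pole \<noteq> antipode pole"
    by (auto simp: pole_def antipode_def fun_eq_iff)
  have "?\<sigma> \<in> sphere_simplices m pi"
    using pole_in_nsphere[of m] dot_ge_minus_1[of _ m] by (auto simp: sphere_simplices_iff)
  moreover have "u \<in> closed_simplex ?\<sigma>"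
    using ne by (auto simp: closed_simplex_def u_def)
  ultimately have "u \<in> topspace (VR_sphere m pi)"
    by (auto simp: VR_sphere_def VR_def topspace_geom_realization)
  moreover have "antipode v = pole \<longleftrightarrow> v = antipode pole" "antipode v = antipode pole \<longleftrightarrow> v = pole" for v
    by (metis antipode_antipode)+
  then have "VR_antipode u = u"
    unfolding VR_antipode_def u_def by auto
  ultimately have "odd_map_VR n m pi (\<lambda>_. u)"
    by (simp add: odd_map_def)
  then show ?thesis by blast
qed

section \<open>The infimum over all scales\<close>

lemma coind_VR_ge_iff:
  assumes "0 < r"
  shows "enat n \<le> coind (VR_sphere m r) VR_antipode \<longleftrightarrow> (\<exists>f. odd_map_VR n m r f)"
proof (cases "n = 0")
  case True
  then show ?thesis
    using odd_map_VR_self[OF assms, of m] odd_map_restrict[of m _ _ _ 0] by (auto simp: zero_enat_def[symmetric])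
qed (use coind_ge_iff in blast)

text \<open>
  The infimum need not be attained, hence the strict inequality between \<open>r\<close> and \<open>r'\<close>. For instance
  \<open>c_VR m m = 0\<close>, but for \<open>m \<ge> 1\<close> the sphere is connected and its complex at scale \<open>0\<close> is discrete.
\<close>
lemma c_VR_le_iff:
  assumes "0 \<le> r" "r < pi"
  shows "c_VR m n \<le> r \<longleftrightarrow> (\<forall>r'. r < r' \<and> r' < pi \<longrightarrow> (\<exists>f. odd_map_VR n m r' f))"
proof -
  let ?R = "{r. 0 \<le> r \<and> enat n \<le> coind (VR_sphere m r) VR_antipode}"
  have bdd: "bdd_below ?R" by (rule bdd_belowI[of _ 0]) auto
  have ne: "pi \<in> ?R"
    using odd_map_VR_pi[of n m] by (simp add: coind_VR_ge_iff)
  show ?thesis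
  proof
    assume c: "c_VR m n \<le> r"
    show "\<forall>r'. r < r' \<and> r' < pi \<longrightarrow> (\<exists>f. odd_map_VR n m r' f)"
    proof (intro allI impI)
      fix r' assume r': "r < r' \<and> r' < pi"
      then have "Inf ?R < r'" using c by (simp add: c_VR_def)
      then obtain q where q: "q \<in> ?R" "q < r'"
        using cInf_lessD[of ?R r'] ne by blast
      show "\<exists>f. odd_map_VR n m r' f"
      proof (cases "n = 0")
        case True
        then show ?thesis
          using odd_map_VR_self[of r' m] odd_map_restrict[of m _ _ _ 0] r' assms by fastforce
      next
        case False
        then obtain f where "odd_map_VR n m q f"
          using q(1) coind_ge_iff[of n] by auto
        then show ?thesis using odd_map_VR_mono q(2) by (metis less_imp_le)
      qed
    qed
  next
    assume *: "\<forall>r'. r < r' \<and> r' < pi \<longrightarrow> (\<exists>f. odd_map_VR n m r' f)"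
    have "Inf ?R \<le> r'" if "r < r'" "r' < pi" for r'
      using * that assms by (intro cInf_lower[OF _ bdd]) (auto simp: coind_VR_ge_iff)
    then show "c_VR m n \<le> r"
      unfolding c_VR_def by (intro dense_ge_bounded[OF assms(2)])
  qed
qed

section \<open>Joins of odd maps\<close>

text \<open>
  The coordinates of a join have the form \<open>a x * h x\<close>, where the direction on which \<open>h\<close> depends is
  undetermined where the weight \<open>a\<close> vanishes; boundedness of \<open>h\<close> suffices there.
\<close>
lemma continuous_map_vanishing_times_bounded:
  fixes a h :: "(nat \<Rightarrow> real) \<Rightarrow> real"
  assumes a: "continuous_map (nsphere n) euclideanreal a"
    and h: "continuous_map (subtopology (nsphere n) {x. a x \<noteq> 0}) euclideanreal h"
    and bounded: "\<And>x. x \<in> topspace (nsphere n) \<Longrightarrow> \<bar>h x\<bar> \<le> 1"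
  shows "continuous_map (nsphere n) euclideanreal (\<lambda>x. a x * h x)"
proof -
  define S where "S = topspace (nsphere n)"
  have S: "nsphere n = top_of_set S"
    by (simp add: S_def nsphere euclidean_product_topology)
  have ca: "continuous_on S a"
    using a by (simp add: S)
  let ?U = "{x \<in> S. a x \<noteq> 0}"
  have ch: "continuous_on ?U h"
    using h by (simp add: S subtopology_subtopology Collect_conj_eq Int_commute)
  have "((\<lambda>x. a x * h x) \<longlongrightarrow> a x * h x) (at x within S)" if x: "x \<in> S" for x
  proof (cases "a x = 0")
    case True
    have "((\<lambda>y. \<bar>a y\<bar>) \<longlongrightarrow> 0) (at x within S)"
      using ca x True by (auto simp: continuous_on_def intro!: tendsto_rabs_zero)
    moreover have "\<forall>\<^sub>F y in at x within S. norm (a y * h y) \<le> \<bar>a y\<bar>"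
      unfolding eventually_at_topological using bounded
      by (intro exI[of _ UNIV]) (auto simp: abs_mult S_def mult_left_le)
    ultimately show ?thesis
      using True by (auto intro: Lim_null_comparison)
  next
    case False
    have "openin (top_of_set S) (S \<inter> a -` (- {0}))"
      by (intro continuous_openin_preimage_gen ca) auto
    then obtain T where T: "open T" "?U = S \<inter> T"
      by (auto simp: openin_open vimage_def)
    have "at x within S = at x within ?U"
      by (rule at_within_nhd[of x T]) (use T x False in auto)
    moreover have "(h \<longlongrightarrow> h x) (at x within ?U)" "(a \<longlongrightarrow> a x) (at x within ?U)"
      using ch continuous_on_subset[OF ca, of ?U] x False by (auto simp: continuous_on_def)
    ultimately show ?thesis
      by (simp add: tendsto_mult)
  qed
  then show ?thesis
    by (simp add: S continuous_on_def)
qed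

text \<open>
  The coordinates of a sphere of dimension \<open>n1 + n2 + 1\<close> form two blocks, starting at \<open>0\<close> and at
  \<open>n1 + 1\<close>. A point is given in join coordinates by the squared norms of its two blocks, which sum
  to \<open>1\<close>, and by the directions of the blocks. A vanishing block gets \<open>pole\<close> as its direction, to
  keep \<open>block_dir\<close> a map into the sphere.
\<close>
definition block_weight :: "nat \<Rightarrow> nat \<Rightarrow> (nat \<Rightarrow> real) \<Rightarrow> real" where
  "block_weight d n x = (\<Sum>i\<le>n. (x (i + d))\<^sup>2)"

definition block_dir :: "nat \<Rightarrow> nat \<Rightarrow> (nat \<Rightarrow> real) \<Rightarrow> (nat \<Rightarrow> real)" where
  "block_dir d n x = (if block_weight d n x = 0 then pole
     else (\<lambda>i. if i \<le> n then x (i + d) / sqrt (block_weight d n x) else 0))"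

lemma block_weight_nonneg: "0 \<le> block_weight d n x"
  by (simp add: block_weight_def sum_nonneg)

lemma block_weight_antipode: "block_weight d n (antipode x) = block_weight d n x"
  by (simp add: block_weight_def antipode_def)

lemma block_dir_antipode:
  "block_weight d n x \<noteq> 0 \<Longrightarrow> block_dir d n (antipode x) = antipode (block_dir d n x)"
  by (rule ext) (simp add: block_dir_def block_weight_antipode, simp add: antipode_def)

lemma continuous_map_block_weight: "continuous_map (nsphere N) euclideanreal (block_weight d n)"
  unfolding block_weight_def[abs_def]
  by (intro continuous_map_sum continuous_map_real_pow continuous_map_nsphere_projection) auto

lemma block_dir_in_nsphere: "block_dir d n x \<in> topspace (nsphere n)"
proof (cases "block_weight d n x = 0")
  case False
  then have pos: "0 < block_weight d n x"
    using block_weight_nonneg[of d n x] by simp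
  have "(\<Sum>i\<le>n. (block_dir d n x i)\<^sup>2) = (\<Sum>i\<le>n. (x (i + d))\<^sup>2) / block_weight d n x"
    using False pos by (simp add: block_dir_def power_divide sum_divide_distrib)
  also have "\<dots> = 1"
    using False by (simp add: block_weight_def)
  finally show ?thesis
    using False by (simp add: nsphere block_dir_def)
qed (simp add: block_dir_def pole_in_nsphere)

lemma continuous_map_block_dir:
  "continuous_map (subtopology (nsphere N) {x. block_weight d n x \<noteq> 0}) (nsphere n) (block_dir d n)"
proof -
  let ?X = "subtopology (nsphere N) {x. block_weight d n x \<noteq> 0}"
  have "continuous_map ?X euclideanreal (\<lambda>x. if i \<le> n then x (i + d) / sqrt (block_weight d n x) else 0)" for i
  proof (cases "i \<le> n")
    case True
    have "continuous_map ?X euclideanreal (\<lambda>x. x (i + d) / sqrt (block_weight d n x))"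
      by (intro continuous_map_real_divide continuous_map_sqrt continuous_map_from_subtopology
          continuous_map_nsphere_projection continuous_map_block_weight) auto
    with True show ?thesis by simp
  qed simp
  then have "continuous_map ?X euclideanreal (\<lambda>x. block_dir d n x i)" for i
    by (rule continuous_map_eq) (auto simp: block_dir_def)
  then have "continuous_map ?X (powertop_real UNIV) (block_dir d n)"
    by (simp add: continuous_map_componentwise_UNIV)
  moreover have "block_dir d n \<in> topspace ?X \<rightarrow> topspace (nsphere n)"
    using block_dir_in_nsphere by auto
  ultimately show ?thesis
    by (subst (2) nsphere) (auto simp: continuous_map_in_subtopology nsphere)
qed

text \<open>
  On the target side, \<open>shift_up d\<close> places a vertex sphere in the block starting at \<open>d\<close>, and
  \<open>embed_coords d\<close> is the induced map on barycentric coordinates: a vertex outside the image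
  of \<open>shift_up d\<close> gets the weight \<open>0\<close>.
\<close>
definition shift_up :: "nat \<Rightarrow> (nat \<Rightarrow> real) \<Rightarrow> (nat \<Rightarrow> real)" where
  "shift_up d v = (\<lambda>i. if i < d then 0 else v (i - d))"

definition embed_coords :: "nat \<Rightarrow> ((nat \<Rightarrow> real) \<Rightarrow> real) \<Rightarrow> ((nat \<Rightarrow> real) \<Rightarrow> real)" where
  "embed_coords d u = (\<lambda>v. if \<forall>i<d. v i = 0 then u (\<lambda>i. v (i + d)) else 0)"

lemma embed_coords_shift_up: "embed_coords d u (shift_up d v) = u v"
  by (simp add: embed_coords_def shift_up_def)

lemma embed_coords_outside:
  assumes "v \<notin> range (shift_up d)" shows "embed_coords d u v = 0"
proof -
  have "v = shift_up d (\<lambda>i. v (i + d))" if "\<forall>i<d. v i = 0"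
    using that by (auto simp: shift_up_def fun_eq_iff)
  then show ?thesis
    using assms by (auto simp: embed_coords_def)
qed

lemma inj_shift_up: "inj (shift_up d)"
proof (rule injI)
  fix v w assume "shift_up d v = shift_up d w"
  then have "shift_up d v (i + d) = shift_up d w (i + d)" for i by simp
  then show "v = w" by (simp add: shift_up_def fun_eq_iff)
qed

lemma embed_coords_simplex:
  assumes "u \<in> closed_simplex \<sigma>"
  shows "embed_coords d u \<in> closed_simplex (shift_up d ` \<sigma>)"
proof -
  have "(\<Sum>v\<in>shift_up d ` \<sigma>. embed_coords d u v) = (\<Sum>v\<in>\<sigma>. u v)"
    by (subst sum.reindex) (auto simp: embed_coords_shift_up intro: inj_on_subset[OF inj_shift_up])
  moreover have "embed_coords d u v = 0" if "v \<notin> shift_up d ` \<sigma>" for v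
  proof (cases "v \<in> range (shift_up d)")
    case True
    then show ?thesis
      using that assms by (auto simp: embed_coords_shift_up closed_simplex_def)
  qed (rule embed_coords_outside)
  ultimately show ?thesis
    using assms by (auto simp: closed_simplex_def embed_coords_def)
qed

lemma embed_coords_antipode: "embed_coords d (VR_antipode u) v = embed_coords d u (antipode v)"
  by (simp add: embed_coords_def VR_antipode_def antipode_def)

lemma convex_combination_simplex:
  assumes "u \<in> closed_simplex \<sigma>" "w \<in> closed_simplex \<tau>" "finite \<sigma>" "finite \<tau>"
    and "0 \<le> a" "0 \<le> b" "a + b = 1"
  shows "(\<lambda>v. a * u v + b * w v) \<in> closed_simplex (\<sigma> \<union> \<tau>)"
proof -
  have "(\<Sum>v\<in>\<sigma> \<union> \<tau>. u v) = (\<Sum>v\<in>\<sigma>. u v)" "(\<Sum>v\<in>\<sigma> \<union> \<tau>. w v) = (\<Sum>v\<in>\<tau>. w v)"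
    by (rule sum.mono_neutral_right; use assms in \<open>auto simp: closed_simplex_def\<close>)+
  then have "(\<Sum>v\<in>\<sigma> \<union> \<tau>. a * u v + b * w v) = 1"
    using assms by (simp add: sum.distrib closed_simplex_def flip: sum_distrib_left)
  then show ?thesis
    using assms by (auto simp: closed_simplex_def)
qed

lemma dot_shift_up:
  assumes v: "v \<in> topspace (nsphere m)" and "m + d \<le> M"
  shows "dot M (shift_up d v) (shift_up d w) = dot m v w"
proof -
  have "dot M (shift_up d v) (shift_up d w)
      = (\<Sum>i\<in>(\<lambda>i. i + d) ` {..m}. shift_up d v i * shift_up d w i)"
  proof (rule sum.mono_neutral_right)
    show "\<forall>i\<in>{..M} - (\<lambda>i. i + d) ` {..m}. shift_up d v i * shift_up d w i = 0"
    proof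
      fix i assume i: "i \<in> {..M} - (\<lambda>i. i + d) ` {..m}"
      then have "i < d \<or> m < i - d"
        by (metis DiffD2 atMost_iff image_eqI le_add_diff_inverse2 not_le)
      then show "shift_up d v i * shift_up d w i = 0"
        using v by (auto simp: shift_up_def nsphere)
    qed
  qed (use assms(2) in auto)
  also have "\<dots> = dot m v w"
    by (subst sum.reindex) (auto simp: shift_up_def)
  finally show ?thesis .
qed

lemma shift_up_in_nsphere:
  assumes "v \<in> topspace (nsphere m)" "m + d \<le> M"
  shows "shift_up d v \<in> topspace (nsphere M)"
  using dot_shift_up[OF assms, of v] dot_self[OF assms(1)] assms
  by (auto simp: nsphere power2_eq_square shift_up_def)

lemma dot_shift_up_orthogonal:
  assumes "v \<in> topspace (nsphere m)" "m < d"
  shows "dot M (shift_up 0 v) (shift_up d w) = 0"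
  using assms by (intro sum.neutral) (auto simp: shift_up_def nsphere)

lemma VR_sphere_support:
  assumes "u \<in> topspace (VR_sphere m r)"
  shows "{v. u v \<noteq> 0} \<in> sphere_simplices m r" "u \<in> closed_simplex {v. u v \<noteq> 0}"
proof -
  obtain \<sigma> where \<sigma>: "\<sigma> \<in> sphere_simplices m r" "u \<in> closed_simplex \<sigma>"
    using assms by (auto simp: VR_sphere_def VR_def topspace_geom_realization)
  let ?s = "{v. u v \<noteq> 0}"
  have sub: "?s \<subseteq> \<sigma>" and fin: "finite \<sigma>"
    using \<sigma> by (auto simp: closed_simplex_def VR_simplices_def)
  have sum: "(\<Sum>v\<in>?s. u v) = (\<Sum>v\<in>\<sigma>. u v)"
    using sub fin by (intro sum.mono_neutral_left) auto
  then show "u \<in> closed_simplex ?s"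
    using \<sigma>(2) by (auto simp: closed_simplex_def)
  have "?s \<noteq> {}"
  proof
    assume "?s = {}"
    then show False using sum \<sigma>(2) unfolding closed_simplex_def by simp
  qed
  moreover have "finite ?s" using finite_subset[OF sub fin] .
  moreover have "diam (sphere_dist m) \<sigma> \<le> r" "\<sigma> \<noteq> {}"
    using \<sigma>(1) by (auto simp: VR_simplices_def)
  ultimately show "?s \<in> sphere_simplices m r"
    using \<sigma>(1) sub fin diam_le_iff[of \<sigma> "sphere_dist m" r] diam_le_iff[of ?s "sphere_dist m" r]
    unfolding VR_simplices_def by blast
qed

lemma VR_sphere_coordinate_bound:
  assumes "u \<in> topspace (VR_sphere m r)"
  shows "\<bar>u v\<bar> \<le> 1"
proof (cases "u v = 0")
  case False
  note u = VR_sphere_support[OF assms]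
  have "u v \<le> (\<Sum>v | u v \<noteq> 0. u v)"
    using u False finite_simplex[OF u(1)] by (intro member_le_sum) (auto simp: closed_simplex_def)
  then show ?thesis
    using u(2) by (simp add: closed_simplex_def)
qed simp

lemma odd_map_in_topspace:
  assumes "odd_map n X \<tau> f" "x \<in> topspace (nsphere n)"
  shows "f x \<in> topspace X"
  using assms by (auto simp: odd_map_def continuous_map_def)

lemma continuous_map_join_summand:
  assumes f: "odd_map_VR n m r f"
  shows "continuous_map (nsphere N) euclideanreal
     (\<lambda>x. block_weight d n x * embed_coords e (f (block_dir d n x)) v)"
proof (rule continuous_map_vanishing_times_bounded[OF continuous_map_block_weight])
  let ?X = "subtopology (nsphere N) {x. block_weight d n x \<noteq> 0}"
  have "continuous_map ?X (VR_sphere m r) (f \<circ> block_dir d n)"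
    using f by (intro continuous_map_compose[OF continuous_map_block_dir]) (simp add: odd_map_def)
  then have "continuous_map ?X euclideanreal ((\<lambda>u. u w) \<circ> (f \<circ> block_dir d n))" for w
    unfolding VR_sphere_def VR_def by (rule continuous_map_compose) (rule continuous_map_coordinate)
  then show "continuous_map ?X euclideanreal (\<lambda>x. embed_coords e (f (block_dir d n x)) v)"
    by (simp add: embed_coords_def o_def)
  show "\<bar>embed_coords e (f (block_dir d n x)) v\<bar> \<le> 1" for x
    using VR_sphere_coordinate_bound[OF odd_map_in_topspace[OF f block_dir_in_nsphere]]
    by (simp add: embed_coords_def)
qed

lemma join_summand_odd:
  assumes f: "odd_map_VR n m r f"
  shows "block_weight d n (antipode x) * embed_coords e (f (block_dir d n (antipode x))) v
       = block_weight d n x * embed_coords e (f (block_dir d n x)) (antipode v)"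
proof (cases "block_weight d n x = 0")
  case False
  have "f (antipode (block_dir d n x)) = VR_antipode (f (block_dir d n x))"
    using f block_dir_in_nsphere by (auto simp: odd_map_def)
  then show ?thesis
    by (simp add: block_weight_antipode block_dir_antipode[OF False] embed_coords_antipode)
qed (simp add: block_weight_antipode)

lemma block_weights_sum:
  assumes "x \<in> topspace (nsphere (n1 + n2 + 1))"
  shows "block_weight 0 n1 x + block_weight (Suc n1) n2 x = 1"
proof -
  have "(\<Sum>i\<le>n1 + k + 1. g i) = (\<Sum>i\<le>n1. g i) + (\<Sum>i\<le>k. g (i + Suc n1))" for g :: "nat \<Rightarrow> real" and k
    by (induction k) (simp_all add: ac_simps)
  from this[where k = n2 and g = "\<lambda>i. (x i)\<^sup>2"] show ?thesis
    using assms by (simp add: block_weight_def nsphere)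
qed

text \<open>
  Vertices in different blocks are orthogonal, and \<open>cos r \<le> 0\<close>; this is where \<open>r \<ge> \<pi> / 2\<close> enters.
\<close>
lemma join_simplex:
  assumes "\<sigma> \<in> sphere_simplices m1 r" "\<tau> \<in> sphere_simplices m2 r" and r: "pi / 2 \<le> r" "r \<le> pi"
  shows "shift_up 0 ` \<sigma> \<union> shift_up (Suc m1) ` \<tau> \<in> sphere_simplices (m1 + m2 + 1) r"
proof -
  have r': "0 \<le> r" "cos r \<le> 0"
    using r cos_monotone_0_pi_le[of "pi / 2" r] by auto
  have \<sigma>: "\<sigma> \<subseteq> topspace (nsphere m1)" "finite \<sigma>" "\<sigma> \<noteq> {}"
      "\<And>x y. x \<in> \<sigma> \<Longrightarrow> y \<in> \<sigma> \<Longrightarrow> cos r \<le> dot m1 x y"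
    using assms(1) unfolding sphere_simplices_iff[OF r'(1) r(2)] by simp_all
  have \<tau>: "\<tau> \<subseteq> topspace (nsphere m2)" "finite \<tau>" "\<tau> \<noteq> {}"
      "\<And>x y. x \<in> \<tau> \<Longrightarrow> y \<in> \<tau> \<Longrightarrow> cos r \<le> dot m2 x y"
    using assms(2) unfolding sphere_simplices_iff[OF r'(1) r(2)] by simp_all
  define M where "M = m1 + m2 + 1"
  define L where "L = shift_up 0 ` \<sigma>"
  define R where "R = shift_up (Suc m1) ` \<tau>"
  have LL: "cos r \<le> dot M x y" if xy: "x \<in> L" "y \<in> L" for x y
  proof -
    obtain a b where ab: "x = shift_up 0 a" "y = shift_up 0 b" "a \<in> \<sigma>" "b \<in> \<sigma>"
      using xy by (auto simp: L_def)
    have "dot M x y = dot m1 a b"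
      unfolding ab(1,2) by (rule dot_shift_up) (use \<sigma>(1) ab(3,4) in \<open>auto simp: M_def\<close>)
    then show ?thesis using \<sigma>(4) ab(3,4) by simp
  qed
  have RR: "cos r \<le> dot M x y" if xy: "x \<in> R" "y \<in> R" for x y
  proof -
    obtain a b where ab: "x = shift_up (Suc m1) a" "y = shift_up (Suc m1) b" "a \<in> \<tau>" "b \<in> \<tau>"
      using xy by (auto simp: R_def)
    have "dot M x y = dot m2 a b"
      unfolding ab(1,2) by (rule dot_shift_up) (use \<tau>(1) ab(3,4) in \<open>auto simp: M_def\<close>)
    then show ?thesis using \<tau>(4) ab(3,4) by simp
  qed
  have LR: "cos r \<le> dot M x y" "cos r \<le> dot M y x" if xy: "x \<in> L" "y \<in> R" for x y
  proof -
    obtain a b where ab: "x = shift_up 0 a" "y = shift_up (Suc m1) b" "a \<in> \<sigma>"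
      using xy by (auto simp: L_def R_def)
    have "dot M x y = 0"
      unfolding ab(1,2) by (rule dot_shift_up_orthogonal) (use \<sigma>(1) ab(3) in auto)
    then show "cos r \<le> dot M x y" "cos r \<le> dot M y x"
      using r'(2) by (simp_all add: mult.commute)
  qed
  have "L \<union> R \<subseteq> topspace (nsphere M)"
    using \<sigma>(1) \<tau>(1) by (auto simp: L_def R_def M_def intro!: shift_up_in_nsphere)
  moreover have "finite (L \<union> R)" "L \<union> R \<noteq> {}"
    using \<sigma>(2,3) \<tau>(2) by (auto simp: L_def R_def)
  moreover have "\<forall>x\<in>L \<union> R. \<forall>y\<in>L \<union> R. cos r \<le> dot M x y"
    using LL RR LR by blast
  ultimately have "L \<union> R \<in> sphere_simplices M r"
    unfolding sphere_simplices_iff[OF r'(1) r(2)] by simp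
  then show ?thesis
    unfolding L_def R_def M_def .
qed

text \<open>
  The join of the two maps, in barycentric coordinates. Since spheres are compact, both maps have
  image in a finite subcomplex, hence so does their join, and its continuity can be checked
  coordinate by coordinate.
\<close>
theorem odd_map_VR_join:
  assumes f1: "odd_map_VR n1 m1 r f1" and f2: "odd_map_VR n2 m2 r f2"
    and r: "pi / 2 \<le> r" "r \<le> pi"
  shows "\<exists>F. odd_map_VR (n1 + n2 + 1) (m1 + m2 + 1) r F"
proof -
  let ?N = "n1 + n2 + 1" and ?M = "m1 + m2 + 1"
  define g1 where "g1 = (\<lambda>x. f1 (block_dir 0 n1 x))"
  define g2 where "g2 = (\<lambda>x. f2 (block_dir (Suc n1) n2 x))"
  define F where "F = (\<lambda>x v. block_weight 0 n1 x * embed_coords 0 (g1 x) v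
     + block_weight (Suc n1) n2 x * embed_coords (Suc m1) (g2 x) v)"
  have g1: "g1 x \<in> topspace (VR_sphere m1 r)" and g2: "g2 x \<in> topspace (VR_sphere m2 r)" for x
    unfolding g1_def g2_def
    by (rule odd_map_in_topspace[OF f1 block_dir_in_nsphere] odd_map_in_topspace[OF f2 block_dir_in_nsphere])+
  define S1 where "S1 = {v. \<exists>y\<in>topspace (nsphere n1). f1 y v \<noteq> 0}"
  define S2 where "S2 = {v. \<exists>y\<in>topspace (nsphere n2). f2 y v \<noteq> 0}"
  have c1: "continuous_map (nsphere n1) (geom_realization (sphere_simplices m1 r)) f1"
    and c2: "continuous_map (nsphere n2) (geom_realization (sphere_simplices m2 r)) f2"
    using f1 f2 by (simp_all add: odd_map_def VR_sphere_def VR_def)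
  have fin: "finite S1" "finite S2"
    unfolding S1_def S2_def
    by (rule compact_image_finite_support[OF compact_space_nsphere c1 finite_simplex]
        compact_image_finite_support[OF compact_space_nsphere c2 finite_simplex], assumption)+
  let ?S = "shift_up 0 ` S1 \<union> shift_up (Suc m1) ` S2"
  have "continuous_map (nsphere ?N) (VR_sphere ?M r) F"
    unfolding VR_sphere_def VR_def
  proof (rule continuous_map_into_geom_realization[of ?S])
    show "continuous_map (nsphere ?N) euclideanreal (\<lambda>x. F x v)" for v
      unfolding F_def g1_def g2_def
      by (intro continuous_map_add continuous_map_join_summand[OF f1] continuous_map_join_summand[OF f2])
    show "finite \<sigma>" if "\<sigma> \<in> sphere_simplices ?M r" for \<sigma>
      using that by (rule finite_simplex)
    fix x assume x: "x \<in> topspace (nsphere ?N)"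
    let ?\<sigma> = "{v. g1 x v \<noteq> 0}" and ?\<tau> = "{v. g2 x v \<noteq> 0}"
    note \<sigma> = VR_sphere_support[OF g1[of x]] and \<tau> = VR_sphere_support[OF g2[of x]]
    let ?\<rho> = "shift_up 0 ` ?\<sigma> \<union> shift_up (Suc m1) ` ?\<tau>"
    have "?\<rho> \<in> sphere_simplices ?M r"
      by (rule join_simplex[OF \<sigma>(1) \<tau>(1) r])
    moreover have "?\<rho> \<subseteq> ?S"
    proof (rule Un_mono; rule image_mono)
      show "?\<sigma> \<subseteq> S1" "?\<tau> \<subseteq> S2"
        using block_dir_in_nsphere by (auto simp: S1_def S2_def g1_def g2_def)
    qed
    moreover have "F x \<in> closed_simplex ?\<rho>"
      unfolding F_def
    proof (rule convex_combination_simplex)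
      show "embed_coords 0 (g1 x) \<in> closed_simplex (shift_up 0 ` ?\<sigma>)"
        "embed_coords (Suc m1) (g2 x) \<in> closed_simplex (shift_up (Suc m1) ` ?\<tau>)"
        using \<sigma>(2) \<tau>(2) by (auto intro: embed_coords_simplex)
      show "finite (shift_up 0 ` ?\<sigma>)" "finite (shift_up (Suc m1) ` ?\<tau>)"
        using finite_simplex[OF \<sigma>(1)] finite_simplex[OF \<tau>(1)] by auto
    qed (simp_all only: block_weight_nonneg block_weights_sum[OF x])
    ultimately show "\<exists>\<sigma>\<in>sphere_simplices ?M r. \<sigma> \<subseteq> ?S \<and> F x \<in> closed_simplex \<sigma>"
      by blast
  qed (use fin in auto)
  moreover have "F (antipode x) = VR_antipode (F x)" for x
    unfolding F_def g1_def g2_def VR_antipode_def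
    by (simp only: join_summand_odd[OF f1] join_summand_odd[OF f2])
  ultimately show ?thesis
    unfolding odd_map_def by (intro exI[of _ F] conjI ballI) auto
qed

section \<open>Superadditive sequences\<close>

text \<open>
  Fekete's lemma. Writing \<open>n = q * k + s\<close> with \<open>1 \<le> s \<le> k\<close>, superadditivity bounds \<open>b n\<close> below by \<open>q * b k\<close>,
  and \<open>q * k \<ge> n - k\<close>; so \<open>b n / n\<close> is eventually almost as large as \<open>b k / k\<close>. The remainder starts at
  \<open>1\<close> since superadditivity is only assumed for positive indices.
\<close>
lemma superadditive_tendsto_SUP:
  fixes b :: "nat \<Rightarrow> nat"
  assumes super: "\<And>j k. 1 \<le> j \<Longrightarrow> 1 \<le> k \<Longrightarrow> b j + b k \<le> b (j + k)"
  shows "(\<lambda>k. ereal (real (b k) / real k)) \<longlonglongrightarrow> (SUP k\<in>{1..}. ereal (real (b k) / real k))"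
    (is "?x \<longlonglongrightarrow> ?L")
proof (rule order_tendstoI)
  fix a assume "a < ?L"
  then obtain k where k: "1 \<le> k" "a < ereal (real (b k) / real k)"
    by (auto simp: less_SUP_iff)
  have multiple: "q * b k + b s \<le> b (q * k + s)" if "1 \<le> s" for q s
  proof (induction q)
    case (Suc q)
    then show ?case
      using super[of k "q * k + s"] k(1) that by (simp add: algebra_simps)
  qed simp
  have lower: "real (b k) / real k - real (b k) / real n \<le> real (b n) / real n" if n: "1 \<le> n" for n
  proof -
    define q where "q = (n - 1) div k"
    define s where "s = (n - 1) mod k + 1"
    have ns: "q * k + s = n" "1 \<le> s" "s \<le> k"
      using n k(1) by (simp_all add: q_def s_def Suc_leI)
    have "n - k \<le> q * k"
      using ns by linarith
    then have "real (n - k) * real (b k) \<le> real (q * k) * real (b k)"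
      by (intro mult_right_mono of_nat_mono) auto
    moreover have "q * b k \<le> b n"
      using multiple[OF ns(2), of q] ns(1) by simp
    then have "real (q * k) * real (b k) \<le> real k * real (b n)"
      using mult_left_mono[of "q * b k" "b n" k] by (simp add: mult.commute mult.left_commute flip: of_nat_mult)
    ultimately have *: "(real n - real k) * real (b k) \<le> real k * real (b n)"
      by (smt (verit) mult_right_mono of_nat_0_le_iff of_nat_diff_real)
    have "real (b k) / real k - real (b k) / real n = (real n - real k) * real (b k) / (real k * real n)"
      using n k(1) by (simp add: field_simps)
    also have "\<dots> \<le> real k * real (b n) / (real k * real n)"
      using * by (intro divide_right_mono) auto
    also have "\<dots> = real (b n) / real n"
      using k(1) by simp
    finally show ?thesis .
  qed
  have "(\<lambda>n. real (b k) / real k - real (b k) / real n) \<longlonglongrightarrow> real (b k) / real k - 0"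
    by (intro tendsto_intros lim_const_over_n)
  then have "\<forall>\<^sub>F n in sequentially. a < ereal (real (b k) / real k - real (b k) / real n)"
    using k(2) by (intro order_tendstoD(1)[where y = "ereal (real (b k) / real k)"]) auto
  then show "\<forall>\<^sub>F n in sequentially. a < ?x n"
    using eventually_ge_at_top[of 1]
  proof eventually_elim
    case (elim n)
    then show ?case
      using lower[of n] by (meson ereal_less_eq(3) less_le_trans)
  qed
next
  fix a assume a: "?L < a"
  show "\<forall>\<^sub>F n in sequentially. ?x n < a"
    using eventually_ge_at_top[of 1]
  proof eventually_elim
    case (elim n)
    then have "?x n \<le> ?L" by (intro SUP_upper) auto
    then show ?case using a by simp
  qed
qed

section \<open>The growth function\<close>

lemma c_VR_self_le:
  assumes "0 \<le> r" "r < pi" shows "c_VR m m \<le> r"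
  using assms by (auto simp: c_VR_le_iff intro: odd_map_VR_self)

lemma c_VR_small_scale:
  assumes "0 \<le> r" "r < pi / 2" "c_VR m n \<le> r"
  shows "n \<le> m"
proof -
  define r' where "r' = (r + pi / 2) / 2"
  have r': "r < r'" "r' < pi / 2" "r' < pi" "r < pi"
    using assms pi_gt_zero by (auto simp: r'_def)
  then obtain f where "odd_map_VR n m r' f"
    using assms(1,3) c_VR_le_iff[of r m n] by blast
  then show ?thesis
    using odd_map_VR_small_scale[of n m r' f] r' assms(1) by simp
qed

lemma finite_c_VR_sublevel:
  assumes "0 \<le> r" "r < pi"
  shows "finite {n. c_VR m n \<le> r}"
proof -
  define r' where "r' = (r + pi) / 2"
  have r': "r < r'" "r' < pi" using assms by (auto simp: r'_def)
  obtain b where b: "\<And>n f. odd_map_VR n m r' f \<Longrightarrow> n < b"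
    using odd_map_VR_bounded[of r' m] r' assms by force
  have "{n. c_VR m n \<le> r} \<subseteq> {..<b}"
    using b r' by (auto simp: c_VR_le_iff[OF assms])
  then show ?thesis
    using finite_subset by blast
qed

text \<open>
  Below \<open>\<pi> / 2\<close> the assumptions force \<open>n1 = m1\<close> and \<open>n2 = m2\<close>; from \<open>\<pi> / 2\<close> on, odd maps are joined at
  every scale above \<open>r\<close>.
\<close>
lemma c_VR_join:
  assumes r: "0 \<le> r" "r < pi"
    and c1: "c_VR m1 n1 \<le> r" "m1 \<le> n1" and c2: "c_VR m2 n2 \<le> r" "m2 \<le> n2"
  shows "c_VR (m1 + m2 + 1) (n1 + n2 + 1) \<le> r"
proof (cases "r < pi / 2")
  case True
  then have "n1 = m1" "n2 = m2"
    using c_VR_small_scale[OF r(1) True] c1 c2 by (auto intro: antisym)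
  then show ?thesis using c_VR_self_le[OF r] by simp
next
  case False
  show ?thesis
    unfolding c_VR_le_iff[OF r]
  proof (intro allI impI)
    fix r' assume r': "r < r' \<and> r' < pi"
    obtain f1 f2 where "odd_map_VR n1 m1 r' f1" "odd_map_VR n2 m2 r' f2"
      using c1(1) c2(1) r' unfolding c_VR_le_iff[OF r] by blast
    then show "\<exists>f. odd_map_VR (n1 + n2 + 1) (m1 + m2 + 1) r' f"
      using False r' by (intro odd_map_VR_join) auto
  qed
qed

lemma finite_B_VR_set:
  assumes "0 \<le> r" "r < pi"
  shows "finite {l. k \<le> l \<and> c_VR (k - 1) (l - 1) \<le> r}"
proof (rule finite_subset)
  show "{l. k \<le> l \<and> c_VR (k - 1) (l - 1) \<le> r} \<subseteq> insert 0 (Suc ` {n. c_VR (k - 1) n \<le> r})"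
  proof
    fix l assume "l \<in> {l. k \<le> l \<and> c_VR (k - 1) (l - 1) \<le> r}"
    then show "l \<in> insert 0 (Suc ` {n. c_VR (k - 1) n \<le> r})"
      by (cases l) auto
  qed
qed (simp add: finite_c_VR_sublevel[OF assms])

lemma B_VR_greatest:
  assumes "0 \<le> r" "r < pi"
  shows "k \<le> B_VR r k" "c_VR (k - 1) (B_VR r k - 1) \<le> r"
    and "\<And>l. k \<le> l \<Longrightarrow> c_VR (k - 1) (l - 1) \<le> r \<Longrightarrow> l \<le> B_VR r k"
proof -
  let ?A = "{l. k \<le> l \<and> c_VR (k - 1) (l - 1) \<le> r}"
  have "k \<in> ?A" using c_VR_self_le[OF assms] by simp
  then have "B_VR r k \<in> ?A"
    unfolding B_VR_def using finite_B_VR_set[OF assms] by (intro Max_in) blast+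
  then show "k \<le> B_VR r k" "c_VR (k - 1) (B_VR r k - 1) \<le> r" by auto
  show "l \<le> B_VR r k" if "k \<le> l" "c_VR (k - 1) (l - 1) \<le> r" for l
    unfolding B_VR_def using finite_B_VR_set[OF assms] that by (intro Max_ge) auto
qed

lemma B_VR_superadditive:
  assumes r: "0 \<le> r" "r < pi" and k: "1 \<le> k1" "1 \<le> k2"
  shows "B_VR r k1 + B_VR r k2 \<le> B_VR r (k1 + k2)"
proof (rule B_VR_greatest(3)[OF r])
  let ?l1 = "B_VR r k1" and ?l2 = "B_VR r k2"
  have l: "k1 \<le> ?l1" "k2 \<le> ?l2" by (rule B_VR_greatest(1)[OF r])+
  then show "k1 + k2 \<le> ?l1 + ?l2" by simp
  have "c_VR ((k1 - 1) + (k2 - 1) + 1) ((?l1 - 1) + (?l2 - 1) + 1) \<le> r"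
    using l by (intro c_VR_join[OF r] B_VR_greatest(2)[OF r]) auto
  moreover have eq: "(k1 - 1) + (k2 - 1) + 1 = k1 + k2 - 1" "(?l1 - 1) + (?l2 - 1) + 1 = ?l1 + ?l2 - 1"
    using k l by auto
  ultimately show "c_VR (k1 + k2 - 1) (?l1 + ?l2 - 1) \<le> r"
    unfolding eq by blast
qed

theorem corollary6p3:
  fixes r :: real
  assumes "0 \<le> r" and "r < pi"
  shows "(\<forall>k1\<ge>1. \<forall>k2\<ge>1. B_VR r k1 + B_VR r k2 \<le> B_VR r (k1 + k2)) \<and>
         (\<lambda>k. ereal (real (B_VR r k) / real k)) \<longlonglongrightarrow> Lambda_VR r \<and>
         Lambda_VR r = (SUP k\<in>{1..}. ereal (real (B_VR r k) / real k)) \<and>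
         1 \<le> Lambda_VR r"
proof -
  let ?q = "\<lambda>k. ereal (real (B_VR r k) / real k)"
  have super: "B_VR r k1 + B_VR r k2 \<le> B_VR r (k1 + k2)" if "1 \<le> k1" "1 \<le> k2" for k1 k2
    using B_VR_superadditive[OF assms that] .
  then have lim: "?q \<longlonglongrightarrow> (SUP k\<in>{1..}. ?q k)"
    by (rule superadditive_tendsto_SUP)
  then have Lambda: "Lambda_VR r = (SUP k\<in>{1..}. ?q k)"
    unfolding Lambda_VR_def by (rule limI)
  have "1 \<le> ?q 1"
    using B_VR_greatest(1)[OF assms, of 1] by (simp add: one_ereal_def)
  also have "\<dots> \<le> Lambda_VR r"
    unfolding Lambda by (rule SUP_upper) simp
  finally show ?thesis
    using super lim Lambda by simp
qed

end
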